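(* Let $m\ge 3$ be an integer and let $\{\xi_n,\,n\ge 1\}$ be independent identically distributed real random variables with $E\xi_i=0$, variance $\sigma^2\in(0,\infty)$, distribution function $F$ and characteristic function $f$, such that the pseudomoments $\mu_k$, $k=3,\dots,m$, exist. Suppose that (i) $A=\int_{\mathbb{R}}|f(t)|\,dt<\infty$; (ii) $\mu_k=0$ for $k=3,\dots,m$, and $\nu_n(m)=\max\{\nu_n^{(1)}(m),\nu_n^{(2)}(m)\}<\frac12 e^{-3/2}$. Then, for all $n\ge 2$ (for which the bound on $\nu_n(m)$ in (ii) holds), $$\sup_{x\in\mathbb{R}}|p_n(x)-\phi(x)|\le C^{(3)}_m\frac{\nu_n^{(1)}(m)}{n^{\frac{m-1}{2}}}+C^{(4)}_m\frac{\nu_n^{(2)}(m)}{n^{\frac{m-2}{2}}}+b^{\,n-1}\frac{\sigma\sqrt n}{2\pi}A+\nu_n(m)\,\frac{e^{3/2}}{\pi}\,\frac{e^{-n/2}}{n},$$ where $$C^{(3)}_m=\frac{12^{\frac{m+2}{2}}\,\Gamma\!\left(\frac m2+1\right)}{4\pi\,(m+1)!},\qquad C^{(4)}_m=2C^{(3)}_{m-1}=\frac{2\cdot 12^{\frac{m+1}{2}}\,\Gamma\!\left(\frac{m+1}{2}\right)}{4\pi\, m!},\qquad b=\exp\left\{-\frac{\pi^2}{24A^2\sigma^2(2+\pi)^2}\right\}<1.$$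
   Context: $\phi(x)=\frac{1}{\sqrt{2\pi}}e^{-x^2/2}$ is the standard normal density, $\Phi$ is the standard normal distribution function, and $p_n$ is the (continuous) density of $S_n=(\sigma\sqrt n)^{-1}(\xi_1+\cdots+\xi_n)$, which exists because of (i). The characteristic function is $f(t)=E e^{it\xi_1}=\int_{\mathbb{R}}e^{itx}\,dF(x)$. Put $H(x)=F(\sigma x)-\Phi(x)$, i.e. $dH$ is the signed measure given by the law of $\xi_1/\sigma$ minus the standard normal law, and let $|dH|$ denote its total variation measure. The pseudomoments are $\mu_k=\int_{\mathbb{R}}x^k\,dH(x)$; their existence for $k\le m$ means that these integrals converge absolutely (equivalently, $E|\xi_1|^m<\infty$). The truncated pseudomoments are $$\nu_n^{(1)}(m)=\int_{|x|\le\sigma\sqrt n}|x|^{m+1}\,|dH(x)|,\qquad \nu_n^{(2)}(m)=\int_{|x|>\sigma\sqrt n}|x|^{m}\,|dH(x)|.$$ $\Gamma$ is the Gamma function. *)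

theory Defs
  imports "HOL-Probability.Probability"
begin

section \<open>Total variation of a set function\<close>

text \<open>
  The distribution has no signed measures. A signed measure on \<open>M\<close> is represented by its
  real-valued set function, and its total variation measure by the usual supremum over finite
  measurable partitions.
\<close>

definition variation :: "'a measure \<Rightarrow> ('a set \<Rightarrow> real) \<Rightarrow> 'a set \<Rightarrow> ennreal" where
  "variation M H A =
     (SUP P \<in> {P. finite P \<and> P \<subseteq> sets M \<and> disjoint P \<and> \<Union>P = A}. \<Sum>B\<in>P. ennreal \<bar>H B\<bar>)"

definition total_variation :: "'a measure \<Rightarrow> ('a set \<Rightarrow> real) \<Rightarrow> 'a measure" where
  "total_variation M H = measure_of (space M) (sets M) (variation M H)"

lemma space_total_variation [simp]: "space (total_variation M H) = space M"
  by (simp add: total_variation_def)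

lemma sets_total_variation [simp, measurable_cong]: "sets (total_variation M H) = sets M"
  by (simp add: total_variation_def)

text \<open>
  For the difference of two finite measures the variation is countably additive, so that
  \<open>measure_of\<close> does not fall back to the null measure.
\<close>

lemma variation_diff_Hahn:
  assumes "finite_measure M" "finite_measure N" and sets_eq: "sets N = sets M"
    and Y: "Y \<in> sets M"
    and pos: "\<And>X. X \<in> sets M \<Longrightarrow> X \<subseteq> Y \<Longrightarrow> measure N X \<le> measure M X"
    and neg: "\<And>X. X \<in> sets M \<Longrightarrow> X \<inter> Y = {} \<Longrightarrow> measure M X \<le> measure N X"
    and A: "A \<in> sets M"
  defines "H \<equiv> \<lambda>B. measure M B - measure N B"
  shows "variation M H A = ennreal (H (A \<inter> Y) - H (A - Y))"
proof -
  interpret M: finite_measure M by fact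
  interpret N: finite_measure N by fact
  have split: "H B = H (B \<inter> Y) + H (B - Y)" if "B \<in> sets M" for B
  proof -
    have "measure M B = measure M (B \<inter> Y) + measure M (B - Y)"
      using M.finite_measure_Union[of "B \<inter> Y" "B - Y"] that Y by (auto simp: Int_Diff_Un)
    moreover have "measure N B = measure N (B \<inter> Y) + measure N (B - Y)"
      using N.finite_measure_Union[of "B \<inter> Y" "B - Y"] that Y by (auto simp: Int_Diff_Un sets_eq)
    ultimately show ?thesis by (simp add: H_def)
  qed
  have Hpos: "0 \<le> H (B \<inter> Y)" if "B \<in> sets M" for B
    using pos[of "B \<inter> Y"] that Y by (auto simp: H_def)
  have Hneg: "H (B - Y) \<le> 0" if "B \<in> sets M" for B
    using neg[of "B - Y"] that Y by (auto simp: H_def)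
  have additive: "(\<Sum>B\<in>P. H (B \<inter> Y) - H (B - Y)) = H (\<Union>P \<inter> Y) - H (\<Union>P - Y)"
    if P: "finite P" "P \<subseteq> sets M" "disjoint P" for P
  proof -
    have dY: "disjoint_family_on (\<lambda>B. B \<inter> Y) P" and dN: "disjoint_family_on (\<lambda>B. B - Y) P"
      using P(3) by (auto simp: disjoint_family_on_def disjoint_def)
    have sY: "(\<lambda>B. B \<inter> Y) ` P \<subseteq> sets M" and sN: "(\<lambda>B. B - Y) ` P \<subseteq> sets M"
      using P(2) Y by auto
    have uY: "(\<Union>B\<in>P. B \<inter> Y) = \<Union>P \<inter> Y" and uN: "(\<Union>B\<in>P. B - Y) = \<Union>P - Y"
      by auto
    show ?thesis
      using M.finite_measure_finite_Union[OF P(1) sY dY] M.finite_measure_finite_Union[OF P(1) sN dN]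
        N.finite_measure_finite_Union[OF P(1) _ dY] N.finite_measure_finite_Union[OF P(1) _ dN] sY sN
      by (simp add: H_def uY uN sets_eq sum_subtractf)
  qed
  show ?thesis
  proof (rule antisym)
    show "variation M H A \<le> ennreal (H (A \<inter> Y) - H (A - Y))"
      unfolding variation_def
    proof (rule SUP_least, safe)
      fix P assume P: "finite P" "P \<subseteq> sets M" "disjoint P" and "A = \<Union>P"
      have "(\<Sum>B\<in>P. ennreal \<bar>H B\<bar>) = ennreal (\<Sum>B\<in>P. \<bar>H B\<bar>)"
        by (simp add: sum_ennreal)
      also have "\<dots> \<le> ennreal (\<Sum>B\<in>P. H (B \<inter> Y) - H (B - Y))"
      proof (intro ennreal_leI sum_mono)
        fix B assume "B \<in> P"
        then have "B \<in> sets M" using P by auto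
        then show "\<bar>H B\<bar> \<le> H (B \<inter> Y) - H (B - Y)"
          using split[of B] Hpos[of B] Hneg[of B] by linarith
      qed
      finally show "(\<Sum>B\<in>P. ennreal \<bar>H B\<bar>) \<le> ennreal (H (\<Union>P \<inter> Y) - H (\<Union>P - Y))"
        by (simp add: additive[OF P])
    qed
    let ?P = "{A \<inter> Y, A - Y}"
    have "ennreal (H (A \<inter> Y) - H (A - Y)) = (\<Sum>B\<in>?P. ennreal \<bar>H B\<bar>)"
    proof (cases "A \<inter> Y = A - Y")
      case True
      then have e: "A \<inter> Y = {}" "A - Y = {}" by auto
      show ?thesis unfolding e by (simp add: H_def)
    next
      case False
      then have "(\<Sum>B\<in>?P. ennreal \<bar>H B\<bar>) = ennreal \<bar>H (A \<inter> Y)\<bar> + ennreal \<bar>H (A - Y)\<bar>"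
        by simp
      also have "\<dots> = ennreal (H (A \<inter> Y) - H (A - Y))"
        using Hpos[OF A] Hneg[OF A] by (simp add: ennreal_plus[symmetric] del: ennreal_plus)
      finally show ?thesis by simp
    qed
    also have "\<dots> \<le> variation M H A"
      unfolding variation_def
      by (rule SUP_upper) (use A Y in \<open>auto simp: disjoint_def\<close>)
    finally show "ennreal (H (A \<inter> Y) - H (A - Y)) \<le> variation M H A" .
  qed
qed

lemma Hahn_decomposition_measure:
  assumes "finite_measure M" "finite_measure N" "sets N = sets M"
  shows "\<exists>Y\<in>sets M. (\<forall>X\<in>sets M. X \<subseteq> Y \<longrightarrow> measure N X \<le> measure M X) \<and>
    (\<forall>X\<in>sets M. X \<inter> Y = {} \<longrightarrow> measure M X \<le> measure N X)"
proof -
  interpret M: finite_measure M by fact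
  interpret N: finite_measure N by fact
  show ?thesis
    using finite_unsigned_Hahn_decomposition[OF assms]
    by (simp add: M.emeasure_eq_measure N.emeasure_eq_measure)
qed

lemma emeasure_total_variation_diff:
  assumes MN: "finite_measure M" "finite_measure N" and sets_eq: "sets N = sets M"
    and A: "A \<in> sets M"
  defines "H \<equiv> \<lambda>B. measure M B - measure N B"
  shows "emeasure (total_variation M H) A = variation M H A"
proof -
  interpret M: finite_measure M by fact
  interpret N: finite_measure N by fact
  obtain Y where Y: "Y \<in> sets M"
    and pos': "\<forall>X\<in>sets M. X \<subseteq> Y \<longrightarrow> measure N X \<le> measure M X"
    and neg': "\<forall>X\<in>sets M. X \<inter> Y = {} \<longrightarrow> measure M X \<le> measure N X"
    using Hahn_decomposition_measure[OF MN sets_eq] by auto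
  have pos: "measure N X \<le> measure M X" if "X \<in> sets M" "X \<subseteq> Y" for X
    using pos' that by simp
  have neg: "measure M X \<le> measure N X" if "X \<in> sets M" "X \<inter> Y = {}" for X
    using neg' that by simp
  have var: "variation M H X = ennreal (H (X \<inter> Y) - H (X - Y))" if "X \<in> sets M" for X
    unfolding H_def by (rule variation_diff_Hahn[OF MN sets_eq Y pos neg that])
  have sums: "(\<lambda>i. H (B i)) sums H (\<Union>i. B i)"
    if "range B \<subseteq> sets M" "disjoint_family B" for B :: "nat \<Rightarrow> 'a set"
    unfolding H_def
    by (rule sums_diff[OF M.finite_measure_UNION[OF that] N.finite_measure_UNION[OF _ that(2)]])
      (simp add: sets_eq that(1))
  have "variation M H {} = 0"
    by (subst var) (simp_all add: H_def)
  then have positive: "positive (sets M) (variation M H)"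
    by (simp add: positive_def)
  have countably_additive: "countably_additive (sets M) (variation M H)"
  proof (rule countably_additiveI)
    fix B :: "nat \<Rightarrow> 'a set"
    assume B: "range B \<subseteq> sets M" "disjoint_family B" "(\<Union>i. B i) \<in> sets M"
    have Bi: "B i \<in> sets M" for i
      using B(1) by auto
    have range: "range (\<lambda>i. B i \<inter> Y) \<subseteq> sets M" "range (\<lambda>i. B i - Y) \<subseteq> sets M"
      using Bi Y by auto
    have disj: "disjoint_family (\<lambda>i. B i \<inter> Y)" "disjoint_family (\<lambda>i. B i - Y)"
      using B(2) unfolding disjoint_family_on_def by blast+
    have Un: "(\<Union>i. B i \<inter> Y) = (\<Union>i. B i) \<inter> Y" "(\<Union>i. B i - Y) = (\<Union>i. B i) - Y"
      by auto
    have "(\<lambda>i. H (B i \<inter> Y) - H (B i - Y)) sums (H ((\<Union>i. B i) \<inter> Y) - H ((\<Union>i. B i) - Y))"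
      by (rule sums_diff[OF sums[OF range(1) disj(1), unfolded Un] sums[OF range(2) disj(2), unfolded Un]])
    moreover have "0 \<le> H (B i \<inter> Y) - H (B i - Y)" for i
    proof -
      have "B i \<inter> Y \<in> sets M" "B i - Y \<in> sets M" "(B i - Y) \<inter> Y = {}"
        using Bi Y by auto
      then show ?thesis
        using pos[of "B i \<inter> Y"] neg[of "B i - Y"] by (simp add: H_def)
    qed
    ultimately have "(\<Sum>i. ennreal (H (B i \<inter> Y) - H (B i - Y)))
        = ennreal (H ((\<Union>i. B i) \<inter> Y) - H ((\<Union>i. B i) - Y))"
      by (rule suminf_ennreal_eq[rotated])
    then show "(\<Sum>i. variation M H (B i)) = variation M H (\<Union>i. B i)"
      by (simp only: var Bi B(3))
  qed
  show ?thesis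
    unfolding total_variation_def
    by (rule emeasure_measure_of_sigma[OF sets.sigma_algebra_axioms positive countably_additive A])
qed


section \<open>The signed measure \<open>dH\<close> and the pseudomoments\<close>

text \<open>
  Throughout, \<open>L\<close> is the common law of the summands, so \<open>cdf L\<close> is \<open>F\<close> and \<open>char L\<close> is \<open>f\<close>.
\<close>

definition scaled_law :: "real measure \<Rightarrow> real \<Rightarrow> real measure" where
  "scaled_law L \<sigma> = distr L borel (\<lambda>x. x / \<sigma>)"

definition std_normal_law :: "real measure" where
  "std_normal_law = density lborel (\<lambda>x. ennreal (std_normal_density x))"

definition dH :: "real measure \<Rightarrow> real \<Rightarrow> real set \<Rightarrow> real" where
  "dH L \<sigma> B = measure (scaled_law L \<sigma>) B - measure std_normal_law B"

definition abs_dH :: "real measure \<Rightarrow> real \<Rightarrow> real measure" where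
  "abs_dH L \<sigma> = total_variation borel (dH L \<sigma>)"

text \<open>
  The \<open>k\<close>-th pseudomoment exists when \<open>x ^ k\<close> is integrable for the total variation measure.
  The normal law has all moments, so then both integrals below converge absolutely.
\<close>

definition pseudomoment_exists :: "real measure \<Rightarrow> real \<Rightarrow> nat \<Rightarrow> bool" where
  "pseudomoment_exists L \<sigma> k \<longleftrightarrow> integrable (abs_dH L \<sigma>) (\<lambda>x. x ^ k)"

definition pseudomoment :: "real measure \<Rightarrow> real \<Rightarrow> nat \<Rightarrow> real" where
  "pseudomoment L \<sigma> k = (LINT x|scaled_law L \<sigma>. x ^ k) - (LINT x|std_normal_law. x ^ k)"

definition nu1 :: "real measure \<Rightarrow> real \<Rightarrow> nat \<Rightarrow> nat \<Rightarrow> real" where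
  "nu1 L \<sigma> n m = (LINT x:{x. \<bar>x\<bar> \<le> \<sigma> * sqrt (real n)}|abs_dH L \<sigma>. \<bar>x\<bar> ^ (m + 1))"

definition nu2 :: "real measure \<Rightarrow> real \<Rightarrow> nat \<Rightarrow> nat \<Rightarrow> real" where
  "nu2 L \<sigma> n m = (LINT x:{x. \<bar>x\<bar> > \<sigma> * sqrt (real n)}|abs_dH L \<sigma>. \<bar>x\<bar> ^ m)"

definition nu :: "real measure \<Rightarrow> real \<Rightarrow> nat \<Rightarrow> nat \<Rightarrow> real" where
  "nu L \<sigma> n m = max (nu1 L \<sigma> n m) (nu2 L \<sigma> n m)"

lemma prob_space_std_normal_law: "prob_space std_normal_law"
  unfolding std_normal_law_def by (rule prob_space_normal_density) simp

lemma dH_atMost: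
  assumes "sets L = sets borel" "\<sigma> > 0"
  shows "dH L \<sigma> {..x} = cdf L (\<sigma> * x) - cdf std_normal_law x"
proof -
  have space: "space L = UNIV" using sets_eq_imp_space_eq[OF assms(1)] by simp
  have "(\<lambda>x. x / \<sigma>) \<in> measurable L borel"
    using assms(1) by (simp cong: measurable_cong_sets)
  then have "measure (scaled_law L \<sigma>) {..x} = measure L ((\<lambda>x. x / \<sigma>) -` {..x} \<inter> space L)"
    unfolding scaled_law_def by (rule measure_distr) simp
  also have "(\<lambda>x. x / \<sigma>) -` {..x} \<inter> space L = {..\<sigma> * x}"
    using assms(2) by (auto simp: space field_simps)
  finally show ?thesis
    by (simp only: dH_def cdf_def)
qed

lemma emeasure_abs_dH:
  assumes "prob_space L" "sets L = sets borel" "A \<in> sets borel"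
  shows "emeasure (abs_dH L \<sigma>) A = variation borel (dH L \<sigma>) A"
proof -
  interpret L: prob_space L by fact
  interpret N: prob_space std_normal_law by (rule prob_space_std_normal_law)
  have "(\<lambda>x. x / \<sigma>) \<in> measurable L borel"
    using assms(2) by (simp cong: measurable_cong_sets)
  then interpret S: prob_space "scaled_law L \<sigma>"
    unfolding scaled_law_def by (rule L.prob_space_distr)
  have sets: "sets (scaled_law L \<sigma>) = sets borel" "sets std_normal_law = sets borel"
    by (simp_all add: scaled_law_def std_normal_law_def)
  have space: "space (scaled_law L \<sigma>) = space borel"
    by (simp add: scaled_law_def)
  have dH: "dH L \<sigma> = (\<lambda>B. measure (scaled_law L \<sigma>) B - measure std_normal_law B)"
    by (rule ext) (rule dH_def)
  have "variation (scaled_law L \<sigma>) H = variation borel H" for H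
    by (rule ext) (simp only: variation_def sets)
  moreover from this have "total_variation (scaled_law L \<sigma>) H = total_variation borel H" for H
    by (simp only: total_variation_def sets space)
  ultimately show ?thesis
    using emeasure_total_variation_diff[OF S.finite_measure_axioms N.finite_measure_axioms, of A]
    unfolding abs_dH_def dH by (simp only: sets assms(3))
qed


section \<open>Continuous densities and normalized sums\<close>

definition is_continuous_density :: "real measure \<Rightarrow> (real \<Rightarrow> real) \<Rightarrow> bool" where
  "is_continuous_density N p \<longleftrightarrow>
     continuous_on UNIV p \<and> (\<forall>x. 0 \<le> p x) \<and> N = density lborel (\<lambda>x. ennreal (p x))"

definition continuous_density :: "real measure \<Rightarrow> real \<Rightarrow> real" where
  "continuous_density N = (THE p. is_continuous_density N p)"

lemma is_continuous_density_unique: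
  assumes p: "is_continuous_density N p" and q: "is_continuous_density N q"
  shows "p = q"
proof -
  have cont: "continuous_on UNIV p" "continuous_on UNIV q"
    and nn: "\<And>x. 0 \<le> p x" "\<And>x. 0 \<le> q x"
    and eq: "density lborel (\<lambda>x. ennreal (p x)) = density lborel (\<lambda>x. ennreal (q x))"
    using p q by (auto simp: is_continuous_density_def)
  have [measurable]: "p \<in> borel_measurable borel" "q \<in> borel_measurable borel"
    using cont by (auto intro: borel_measurable_continuous_onI)
  have "AE x in lborel. ennreal (p x) = ennreal (q x)"
    using eq by (subst (asm) sigma_finite_measure.density_unique_iff[OF sigma_finite_lborel]) auto
  then have "AE x in lborel. p x = q x"
    by eventually_elim (simp add: nn)
  then have "{x. p x \<noteq> q x} \<in> null_sets lborel"
    by (simp add: AE_iff_null)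
  then have "negligible {x. p x \<noteq> q x}"
    by (simp add: negligible_iff_null_sets null_sets_completionI)
  moreover have "open {x. p x \<noteq> q x}"
    using cont by (intro open_Collect_neq)
  ultimately have "{x. p x \<noteq> q x} = {}"
    using open_not_negligible by blast
  then show ?thesis by auto
qed

lemma continuous_density_eq: "is_continuous_density N p \<Longrightarrow> continuous_density N = p"
  unfolding continuous_density_def
  by (rule the_equality) (auto dest: is_continuous_density_unique)

definition normalized_sum :: "(nat \<Rightarrow> 'a \<Rightarrow> real) \<Rightarrow> real \<Rightarrow> nat \<Rightarrow> 'a \<Rightarrow> real" where
  "normalized_sum \<xi> \<sigma> n \<omega> = (\<Sum>i=1..n. \<xi> i \<omega>) / (\<sigma> * sqrt (real n))"


section \<open>Constants\<close>

definition C3 :: "nat \<Rightarrow> real" where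
  "C3 m = 12 powr ((real m + 2) / 2) * Gamma (real m / 2 + 1) / (4 * pi * fact (m + 1))"

definition C4 :: "nat \<Rightarrow> real" where
  "C4 m = 2 * 12 powr ((real m + 1) / 2) * Gamma ((real m + 1) / 2) / (4 * pi * fact m)"

lemma C4_eq:
  assumes "m \<ge> 1"
  shows "C4 m = 2 * C3 (m - 1)"
proof -
  have eqs: "real (m - 1) / 2 + 1 = (real m + 1) / 2" "real (m - 1) + 2 = real m + 1" "m - 1 + 1 = m"
    using assms by (auto simp: of_nat_diff field_simps)
  show ?thesis unfolding C3_def C4_def eqs by simp
qed

definition b_const :: "real \<Rightarrow> real \<Rightarrow> real" where
  "b_const A \<sigma> = exp (- (pi\<^sup>2 / (24 * A\<^sup>2 * \<sigma>\<^sup>2 * (2 + pi)\<^sup>2)))"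

end

theory Submission
  imports Defs
begin

text \<open>
  Let \<open>g s = f (s / \<sigma>)\<close>. Fourier inversion bounds the distance of the densities by
  \<open>1 / (2 \<pi>)\<close> times the integral of \<open>\<bar>g (t / sqrt n) ^ n - exp (- t\<^sup>2 / 2)\<bar>\<close>. The vanishing
  pseudomoments and Taylor's formula give
  \<open>\<bar>g s - exp (- s\<^sup>2 / 2)\<bar> \<le> \<bar>s\<bar>^(m+1) \<nu>\<^sub>1 / (m+1)! + 2 \<bar>s\<bar>^m \<nu>\<^sub>2 / m!\<close>. Put \<open>s = t / sqrt n\<close>.

  Where \<open>\<nu> \<le> exp (- s\<^sup>2)\<close>, this estimate implies \<open>\<bar>g s\<bar> \<le> exp (- s\<^sup>2 / 4)\<close>, so the difference of the
  \<open>n\<close>-th powers is at most \<open>n \<bar>g s - exp (- s\<^sup>2 / 2)\<bar> exp (- t\<^sup>2 / 8)\<close>, whose integral gives the first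
  two terms. Where \<open>\<nu> > exp (- s\<^sup>2)\<close>, one has \<open>\<bar>s\<bar> \<ge> 1\<close>, hence \<open>\<bar>g s\<bar> \<le> b\<close> because the density of the
  summands is bounded by \<open>A / (2 \<pi>)\<close>; this gives the third term, and the Gaussian tail the fourth.
\<close>

subsection \<open>Fourier inversion for integrable characteristic functions\<close>

text \<open>The bound \<open>1 / 2 * exp (- 3 / 2)\<close> on \<nu> serves three times. It is below
  exp(-1), which is why \<nu> > exp(-s^2) forces |s| \<ge> 1. It is below exp(-2), which lets the
  factor \<nu>^(n/2) of the Gaussian tail be traded for \<nu> exp(-n/2) as soon as n \<ge> 2. And
  its geometric mean with exp(-s^2) is a multiple of exp(-s^2/2) small enough to keep |g s| below
  exp(-s^2/4). The ranges meet where exp(-s^2) equals \<nu>, because a fixed cut would leave a tail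
  that does not vanish with \<nu>. The factor exp(-t^2/8) comes from n - 1 powers of exp(-s^2/4),
  the worst case being n = 2. It produces powers of 8, whereas the constants have powers of 12, and
  4 pi in place of 2 pi; the surplus pays for the factor 2. The bound on |g s| for |s| \<ge> 1
  likewise comes out with \<open>32 * (1 + pi)\<^sup>2\<close> where b has the larger
  \<open>24 * (2 + pi)\<^sup>2\<close>. Levy's inversion formula speaks only about intervals whose
  end points carry no mass, so atoms have to be excluded before a density can be obtained.\<close>

definition inverse_char :: "(real \<Rightarrow> complex) \<Rightarrow> real \<Rightarrow> complex" where
  "inverse_char f x = (CLBINT t. iexp (- (t * x)) * f t) / (2 * pi)"

lemma integrable_iexp_mult:
  fixes f :: "real \<Rightarrow> complex"
  assumes [measurable]: "f \<in> borel_measurable borel" and "integrable lborel (\<lambda>t. cmod (f t))"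
  shows "integrable lborel (\<lambda>t. iexp (- (t * x)) * f t)"
  by (rule Bochner_Integration.integrable_bound[OF assms(2)]) (auto simp: norm_mult)

lemma isCont_inverse_char:
  fixes f :: "real \<Rightarrow> complex"
  assumes [measurable]: "f \<in> borel_measurable borel" and int: "integrable lborel (\<lambda>t. cmod (f t))"
  shows "isCont (inverse_char f) x"
  unfolding continuous_at_sequentially
proof safe
  fix X assume X: "X \<longlonglongrightarrow> x"
  have "(\<lambda>n. CLBINT t. iexp (- (t * X n)) * f t) \<longlonglongrightarrow> (CLBINT t. iexp (- (t * x)) * f t)"
    by (rule integral_dominated_convergence[OF _ _ int])
      (auto intro!: tendsto_intros X simp: norm_mult)
  then show "(inverse_char f \<circ> X) \<longlonglongrightarrow> inverse_char f x"
    unfolding inverse_char_def o_def by (auto intro!: tendsto_intros)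
qed

lemma cmod_inverse_char_diff_le:
  fixes f :: "real \<Rightarrow> complex"
  assumes [measurable]: "f \<in> borel_measurable borel" "g \<in> borel_measurable borel"
    and f: "integrable lborel (\<lambda>t. cmod (f t))" and g: "integrable lborel (\<lambda>t. cmod (g t))"
  shows "cmod (inverse_char f x - inverse_char g x) \<le> (LBINT t. cmod (f t - g t)) / (2 * pi)"
proof -
  have "inverse_char f x - inverse_char g x = (CLBINT t. iexp (- (t * x)) * (f t - g t)) / (2 * pi)"
    unfolding inverse_char_def
    unfolding right_diff_distrib
    by (subst Bochner_Integration.integral_diff)
      (simp_all only: integrable_iexp_mult f g assms diff_divide_distrib)
  also have "cmod \<dots> \<le> (LBINT t. cmod (iexp (- (t * x)) * (f t - g t))) / (2 * pi)"
    unfolding norm_divide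
    by (rule frac_le) (auto intro!: integral_nonneg_AE integral_norm_bound)
  finally show ?thesis
    by (simp add: norm_mult)
qed

lemma cmod_inverse_char_le:
  fixes f :: "real \<Rightarrow> complex"
  assumes "f \<in> borel_measurable borel" and "integrable lborel (\<lambda>t. cmod (f t))"
  shows "cmod (inverse_char f x) \<le> (LBINT t. cmod (f t)) / (2 * pi)"
  using cmod_inverse_char_diff_le[of f "\<lambda>_. 0" x] assms by (simp add: inverse_char_def)

text \<open>Read from right to left: the kernel of Levy's inversion formula becomes an integral over
  \<open>x\<close>, which Fubini can then exchange with the integral over \<open>t\<close>.\<close>

lemma integral_iexp_interval:
  fixes a b t :: real
  assumes "a \<le> b" "t \<noteq> 0"
  shows "(CLBINT x. indicator {a..b} x *\<^sub>R iexp (- (t * x))) = (iexp (- (t * a)) - iexp (- (t * b))) / (\<i> * t)"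
proof -
  have "(CLBINT x. indicator {a..b} x *\<^sub>R iexp (- (t * x))) = \<i> * iexp (- (t * b)) / t - \<i> * iexp (- (t * a)) / t"
  proof (rule integral_FTC_atLeastAtMost[OF assms(1)])
    show "((\<lambda>x. \<i> * iexp (- (t * x)) / t) has_vector_derivative iexp (- (t * x))) (at x within {a..b})" for x
      unfolding has_vector_derivative_complex_iff
      using assms(2) by (auto intro!: derivative_eq_intros simp: Re_exp Im_exp)
  qed (auto intro!: continuous_intros)
  also have "\<dots> = (iexp (- (t * a)) - iexp (- (t * b))) / (\<i> * t)"
  proof -
    have "\<i> * w / t - \<i> * z / t = (z - w) / (\<i> * t)" for w z
      using assms(2) by (simp add: field_simps)
    then show ?thesis by blast
  qed
  finally show ?thesis .
qed

context real_distribution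
begin

text \<open>The kernel is at most \<open>b - a\<close> in norm, so integrability of
  \<open>char M\<close> dominates the truncated integrals in Levy's formula; the limit is one
  absolutely convergent integral, to which Fubini applies. Taking real parts at the end avoids a
  proof that the inversion integral is real.\<close>

lemma measure_eq_integral_inverse_char:
  assumes int: "integrable lborel (\<lambda>t. cmod (char M t))"
    and ab: "a \<le> b" and atoms: "measure M {a} = 0" "measure M {b} = 0"
  shows "measure M {a<..b} = (LBINT x. indicator {a..b} x *\<^sub>R Re (inverse_char (char M) x))"
proof -
  let ?D = "\<lambda>t. (iexp (- (t * a)) - iexp (- (t * b))) / (\<i> * complex_of_real t)"
  \<comment> \<open>At \<open>t = 0\<close> the kernel is 0 by the convention for division by
    zero.\<close>
  have D: "cmod (?D t) \<le> b - a" for t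
  proof (cases "t = 0")
    case False
    have "?D t = (iexp (t * - a) - iexp (t * - b)) / (\<i> * t)" by simp
    then show ?thesis
      using Levy_Inversion_aux2[of "- b" "- a" t] ab False by simp
  qed (use ab in auto)
  have bound: "cmod (?D t * char M t) \<le> (b - a) * cmod (char M t)" for t
    unfolding norm_mult using D by (intro mult_right_mono) auto
  have "(\<lambda>T. CLBINT t. indicator {- real T<..<real T} t *\<^sub>R (?D t * char M t)) \<longlonglongrightarrow> (CLBINT t. ?D t * char M t)"
  proof (rule integral_dominated_convergence[where w="\<lambda>t. (b - a) * cmod (char M t)"])
    show "integrable lborel (\<lambda>t. (b - a) * cmod (char M t))"
      using int by simp
    show "AE t in lborel. (\<lambda>T. indicator {- real T<..<real T} t *\<^sub>R (?D t * char M t)) \<longlonglongrightarrow> ?D t * char M t"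
    proof (rule AE_I2)
      fix t :: real
      obtain N :: nat where N: "\<bar>t\<bar> < real N" using reals_Archimedean2 by blast
      have "eventually (\<lambda>T. indicator {- real T<..<real T} t *\<^sub>R (?D t * char M t) = ?D t * char M t) sequentially"
        using eventually_ge_at_top[of N] by eventually_elim (use N in \<open>auto simp: indicator_def\<close>)
      then show "(\<lambda>T. indicator {- real T<..<real T} t *\<^sub>R (?D t * char M t)) \<longlonglongrightarrow> ?D t * char M t"
        by (rule tendsto_eventually)
    qed
    show "AE t in lborel. cmod (indicator {- real T<..<real T} t *\<^sub>R (?D t * char M t)) \<le> (b - a) * cmod (char M t)" for T
      using bound order_trans[OF _ bound] ab by (intro AE_I2) (auto simp: indicator_def simp del: norm_mult)
  qed auto
  then have "(\<lambda>T. 1 / (2 * pi) * (CLBINT t=-real T..real T. ?D t * char M t)) \<longlonglongrightarrow> 1 / (2 * pi) * (CLBINT t. ?D t * char M t)"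
    by (intro tendsto_intros) (simp add: interval_lebesgue_integral_def set_lebesgue_integral_def)
  from LIMSEQ_unique[OF Levy_Inversion[OF ab atoms, unfolded of_int_minus of_int_of_nat_eq] this]
  have "complex_of_real (measure M {a<..b}) = 1 / (2 * pi) * (CLBINT t. ?D t * char M t)" .
  also have "(CLBINT t. ?D t * char M t) = (CLBINT t. CLBINT x. indicator {a..b} x *\<^sub>R (iexp (- (t * x)) * char M t))"
  proof (rule integral_cong_AE)
    \<comment> \<open>At the single point \<open>t = 0\<close> the kernel is 0 while the integral
      over \<open>x\<close> is not, so the two agree only almost everywhere.\<close>
    have "AE t in lborel. t \<noteq> (0::real)" by (rule AE_lborel_singleton)
    then show "AE t in lborel. ?D t * char M t = (CLBINT x. indicator {a..b} x *\<^sub>R (iexp (- (t * x)) * char M t))"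
    proof eventually_elim
      case (elim t)
      show ?case
        unfolding integral_iexp_interval[OF ab elim, symmetric]
        by (simp only: mult_scaleR_left[symmetric] integral_mult_left_zero)
    qed
  qed auto
  also have "\<dots> = (CLBINT x. CLBINT t. indicator {a..b} x *\<^sub>R (iexp (- (t * x)) * char M t))"
  proof (rule lborel_pair.Fubini_integral)
    show "integrable (lborel \<Otimes>\<^sub>M lborel) (\<lambda>(x, t). indicator {a..b} x *\<^sub>R (iexp (- (t * x)) * char M t))"
    proof (rule lborel_pair.Fubini_integrable)
      show "integrable lborel (\<lambda>x. LBINT t. norm (case (x, t) of (x, t) \<Rightarrow> indicator {a..b} x *\<^sub>R (iexp (- (t * x)) * char M t)))"
        by (simp add: norm_mult) (auto intro!: integrable_real_indicator simp: emeasure_lborel_Icc_eq)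
      show "AE x in lborel. integrable lborel (\<lambda>t. case (x, t) of (x, t) \<Rightarrow> indicator {a..b} x *\<^sub>R (iexp (- (t * x)) * char M t))"
        using integrable_iexp_mult[OF _ int] by auto
    qed simp
  qed
  also have "\<dots> = (CLBINT x. 2 * pi * (indicator {a..b} x *\<^sub>R inverse_char (char M) x))"
    by (simp add: inverse_char_def)
  also have "1 / (2 * pi) * \<dots> = (CLBINT x. indicator {a..b} x *\<^sub>R inverse_char (char M) x)"
    by (subst integral_mult_right_zero) simp
  finally have eq: "complex_of_real (measure M {a<..b}) = (CLBINT x. indicator {a..b} x *\<^sub>R inverse_char (char M) x)" .
  have "integrable lborel (\<lambda>x. indicator {a..b} x *\<^sub>R inverse_char (char M) x)"
    using isCont_inverse_char[OF char_measurable int]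
    by (intro borel_integrable_compact) (auto intro!: continuous_at_imp_continuous_on)
  then have "Re (complex_of_real (measure M {a<..b})) = (LBINT x. Re (indicator {a..b} x *\<^sub>R inverse_char (char M) x))"
    unfolding eq by (rule integral_Re[symmetric])
  then show ?thesis
    by simp
qed

section \<open>Absence of atoms and the continuous density\<close>

lemma exists_non_atom:
  assumes "c < (d :: real)"
  obtains z where "c < z" "z < d" "measure M {z} = 0"
proof -
  have "\<not> {c<..<d} \<subseteq> {z. measure M {z} > 0}"
    using countable_subset[OF _ countable_atoms] uncountable_open_interval assms by blast
  then show ?thesis
    using that by (auto simp: zero_less_measure_iff)
qed

text \<open>Non-atoms are dense, so \<open>x\<close> lies in arbitrarily short intervals to which
  the inversion formula applies; there the bounded integrand leaves mass at most \<open>K\<close>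
  times the length.\<close>

lemma measure_singleton_eq_0_if_char_integrable:
  assumes int: "integrable lborel (\<lambda>t. cmod (char M t))"
  shows "measure M {x} = 0"
proof (rule ccontr)
  define K where "K = (LBINT t. cmod (char M t)) / (2 * pi)"
  have K: "cmod (inverse_char (char M) y) \<le> K" for y
    unfolding K_def by (rule cmod_inverse_char_le[OF char_measurable int])
  then have "0 \<le> K"
    using norm_ge_zero order_trans by blast
  assume "measure M {x} \<noteq> 0"
  then have pos: "0 < measure M {x}"
    by (simp add: zero_less_measure_iff)
  \<comment> \<open>The interval from \<open>c\<close> to \<open>d\<close> will be shorter than
    \<open>2 * \<epsilon>\<close>, so its mass is at most half of that of \<open>x\<close>. Using
    \<open>K + 1\<close> guards against \<open>K = 0\<close>.\<close>
  define \<epsilon> where "\<epsilon> = measure M {x} / (4 * (K + 1))"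
  have "0 < \<epsilon>"
    unfolding \<epsilon>_def using pos \<open>0 \<le> K\<close> by simp
  obtain c where c: "x - \<epsilon> < c" "c < x" "measure M {c} = 0"
    using exists_non_atom[of "x - \<epsilon>" x] \<open>0 < \<epsilon>\<close> by auto
  obtain d where d: "x < d" "d < x + \<epsilon>" "measure M {d} = 0"
    using exists_non_atom[of x "x + \<epsilon>"] \<open>0 < \<epsilon>\<close> by auto
  have "measure M {x} \<le> measure M {c<..d}"
    using c d by (intro finite_measure_mono) auto
  also have "\<dots> = (LBINT y. indicator {c..d} y *\<^sub>R Re (inverse_char (char M) y))"
    using c d by (intro measure_eq_integral_inverse_char[OF int]) auto
  also have "\<dots> \<le> (LBINT y. K * indicator {c..d} y)"
  proof (rule integral_mono)
    show "integrable lborel (\<lambda>y. indicator {c..d} y *\<^sub>R Re (inverse_char (char M) y))"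
      using isCont_inverse_char[OF char_measurable int]
      by (intro borel_integrable_compact) (auto intro!: continuous_at_imp_continuous_on continuous_intros)
    show "indicator {c..d} y *\<^sub>R Re (inverse_char (char M) y) \<le> K * indicator {c..d} y" for y
      using order_trans[OF complex_Re_le_cmod K] by (auto simp: indicator_def)
  qed (auto intro!: integrable_real_indicator simp: emeasure_lborel_Icc_eq)
  also have "\<dots> = K * (d - c)"
    using c d by simp
  also have "\<dots> \<le> (K + 1) * (2 * \<epsilon>)"
    using c d \<open>0 \<le> K\<close> by (intro mult_mono) auto
  also have "\<dots> < measure M {x}"
    unfolding \<epsilon>_def using pos \<open>0 \<le> K\<close> by (simp add: divide_simps)
  finally show False by simp
qed

text \<open>Without atoms the inversion formula holds on every interval, so near \<open>x\<close>
  the distribution function is a constant plus an integral of a continuous function. The base point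
  \<open>x - 1\<close> only serves to make \<open>x\<close> interior.\<close>

lemma DERIV_cdf_inverse_char:
  assumes int: "integrable lborel (\<lambda>t. cmod (char M t))"
  shows "DERIV (cdf M) x :> Re (inverse_char (char M) x)"
proof -
  let ?p = "\<lambda>x. Re (inverse_char (char M) x)"
  have cont: "continuous_on S ?p" for S
    using isCont_inverse_char[OF char_measurable int]
    by (auto intro!: continuous_at_imp_continuous_on continuous_intros)
  have cdf: "cdf M u = cdf M (x - 1) + integral {x - 1..u} ?p" if "x - 1 \<le> u" for u
  proof -
    have "set_integrable lborel {x - 1..u} ?p"
      unfolding set_integrable_def by (intro borel_integrable_compact cont) auto
    then have "measure M {x - 1<..u} = integral {x - 1..u} ?p"
      using measure_eq_integral_inverse_char[OF int that] measure_singleton_eq_0_if_char_integrable[OF int]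
      by (simp add: set_borel_integral_eq_integral(2)[symmetric] set_lebesgue_integral_def)
    then show ?thesis
      using cdf_diff_eq[of "x - 1" u] that by (cases "u = x - 1") auto
  qed
  have "((\<lambda>u. cdf M (x - 1) + integral {x - 1..u} ?p) has_real_derivative ?p x) (at x within {x - 1..x + 1})"
    using integral_has_real_derivative[OF cont, of x "x - 1" "x + 1"] by (auto intro!: derivative_eq_intros)
  then have "(cdf M has_real_derivative ?p x) (at x within {x - 1..x + 1})"
    by (rule has_field_derivative_transform_within[where d=1]) (auto intro!: cdf[symmetric])
  then show ?thesis
    by (simp add: at_within_Icc_at)
qed

text \<open>Since \<open>cdf M\<close> is an antiderivative of the continuous candidate, its
  monotonicity gives the sign, and the fundamental theorem up to infinity gives the mass of every
  half-line, which determines the measure.\<close>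

theorem is_continuous_density_inverse_char:
  assumes int: "integrable lborel (\<lambda>t. cmod (char M t))"
  shows "is_continuous_density M (\<lambda>x. Re (inverse_char (char M) x))"
  unfolding is_continuous_density_def
proof (intro conjI allI)
  let ?p = "\<lambda>x. Re (inverse_char (char M) x)"
  show cont: "continuous_on UNIV ?p"
    using isCont_inverse_char[OF char_measurable int]
    by (auto intro!: continuous_at_imp_continuous_on continuous_intros)
  then have [measurable]: "?p \<in> borel_measurable borel"
    by (rule borel_measurable_continuous_onI)
  show nonneg: "0 \<le> ?p x" for x
  proof (rule ccontr)
    assume "\<not> 0 \<le> ?p x"
    then obtain d where "d > 0" and d: "\<And>h. 0 < h \<Longrightarrow> h < d \<Longrightarrow> cdf M (x + h) < cdf M x"
      using has_real_derivative_neg_dec_right[OF DERIV_cdf_inverse_char[OF int, of x]] by auto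
    have "cdf M (x + d / 2) < cdf M x"
      by (rule d) (use \<open>d > 0\<close> in auto)
    moreover have "cdf M x \<le> cdf M (x + d / 2)"
      by (rule cdf_nondecreasing) (use \<open>d > 0\<close> in auto)
    ultimately show False
      by linarith
  qed
  show "M = density lborel (\<lambda>x. ennreal (?p x))"
  proof (rule measure_eqI_lessThan)
    fix x :: real
    show "emeasure M {x<..} < \<infinity>"
      by (simp add: emeasure_eq_measure)
    have "emeasure (density lborel (\<lambda>x. ennreal (?p x))) {x<..} = (\<integral>\<^sup>+y. ennreal (?p y) * indicator {x<..} y \<partial>lborel)"
      by (subst emeasure_density) auto
    also have "\<dots> = (\<integral>\<^sup>+y. ennreal (?p y) * indicator {x..} y \<partial>lborel)"
      by (rule nn_integral_cong_AE) (use AE_lborel_singleton[of x] in \<open>eventually_elim, auto simp: indicator_def\<close>)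
    also have "\<dots> = ennreal (1 - cdf M x)"
      by (rule nn_integral_FTC_atLeast[OF _ _ _ cdf_lim_at_top_prob]) (auto intro: DERIV_cdf_inverse_char[OF int] nonneg)
    also have "1 - cdf M x = measure M {x<..}"
      using prob_compl[of "{..x}"] by (simp add: cdf_def Compl_eq_Diff_UNIV[symmetric])
    finally show "emeasure M {x<..} = emeasure (density lborel (\<lambda>x. ennreal (?p x))) {x<..}"
      by (simp add: emeasure_eq_measure)
  qed auto
qed

end

subsection \<open>Differences of measures\<close>

text \<open>Domination of \<open>M\<close> by the sum of \<open>N\<close> and \<open>D\<close>
  passes from indicators to nonnegative functions by the usual approximation. In the application
  \<open>D\<close> is the total variation of the difference.\<close>

lemma nn_integral_le_add_measure:
  assumes sets: "sets N = sets M" "sets D = sets M"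
    and le: "\<And>A. A \<in> sets M \<Longrightarrow> emeasure M A \<le> emeasure N A + emeasure D A"
    and u: "u \<in> borel_measurable M"
  shows "(\<integral>\<^sup>+x. u x \<partial>M) \<le> (\<integral>\<^sup>+x. u x \<partial>N) + (\<integral>\<^sup>+x. u x \<partial>D)"
proof -
  note [measurable_cong] = sets
  have space: "space N = space M" "space D = space M"
    using sets by (auto dest: sets_eq_imp_space_eq)
  show ?thesis
    using u
  proof (induct u rule: borel_measurable_induct)
    case (cong f g)
    then show ?case
      using nn_integral_cong[of M f g] nn_integral_cong[of N f g] nn_integral_cong[of D f g] by (simp add: space)
  next
    case (set A)
    then show ?case
      using le by (simp add: sets)
  next
    case (mult u c)
    note [measurable] = mult(2)
    show ?case
      using mult_left_mono[OF mult(4), of c] by (simp add: nn_integral_cmult distrib_left)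
  next
    case (add u v)
    note [measurable] = add(1,4)
    show ?case
      using add_mono[OF add(3,7)] by (simp add: nn_integral_add ac_simps)
  next
    case (seq U)
    note [measurable] = seq(1)
    have "(\<integral>\<^sup>+x. (SUP i. U i) x \<partial>M) = (SUP i. \<integral>\<^sup>+x. U i x \<partial>M)"
      unfolding SUP_apply by (rule nn_integral_monotone_convergence_SUP[OF seq(4)]) simp
    also have "\<dots> \<le> (\<integral>\<^sup>+x. (SUP i. U i) x \<partial>N) + (\<integral>\<^sup>+x. (SUP i. U i) x \<partial>D)"
      by (rule SUP_least, rule order_trans[OF seq(3)], intro add_mono nn_integral_mono)
        (auto intro!: SUP_upper simp: le_fun_def)
    finally show ?case .
  qed
qed

text \<open>No integral against a signed measure is formed. The positive part of \<open>v\<close>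
  uses that \<open>M\<close> is dominated by \<open>N\<close> plus \<open>D\<close>, the negative
  part uses the reverse domination, and the two parts add up to |v| under \<open>D\<close>.\<close>

lemma integral_diff_le_add_measure:
  fixes v w :: "'a \<Rightarrow> real"
  assumes sets: "sets N = sets M" "sets D = sets M"
    and MN: "\<And>A. A \<in> sets M \<Longrightarrow> emeasure M A \<le> emeasure N A + emeasure D A"
    and NM: "\<And>A. A \<in> sets M \<Longrightarrow> emeasure N A \<le> emeasure M A + emeasure D A"
    and v: "integrable M v" "integrable N v" and w: "integrable D w"
    and vw: "\<And>x. \<bar>v x\<bar> \<le> w x"
  shows "(LINT x|M. v x) - (LINT x|N. v x) \<le> (LINT x|D. w x)"
proof -
  note [measurable_cong] = sets
  have [measurable]: "v \<in> borel_measurable M"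
    using v by auto
  define p q where "p x = max 0 (v x)" and "q x = max 0 (- v x)" for x
  have [measurable]: "p \<in> borel_measurable M" "q \<in> borel_measurable M"
    unfolding p_def q_def by auto
  have pq: "v x = p x - q x" "0 \<le> p x" "0 \<le> q x" "p x + q x = \<bar>v x\<bar>" for x
    by (auto simp: p_def q_def)
  have iM: "integrable M p" "integrable M q" and iN: "integrable N p" "integrable N q"
    using v by (auto simp: p_def[abs_def] q_def[abs_def] intro!: integrable_max)
  have iD: "integrable D p" "integrable D q"
  proof -
    have "norm (p x) \<le> norm (w x)" "norm (q x) \<le> norm (w x)" for x
      using vw[of x] by (auto simp: p_def q_def)
    then show "integrable D p" "integrable D q"
      by (auto intro!: Bochner_Integration.integrable_bound[OF w])
  qed
  have 1: "(LINT x|M. p x) \<le> (LINT x|N. p x) + (LINT x|D. p x)"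
  proof -
    have "ennreal (LINT x|M. p x) \<le> ennreal ((LINT x|N. p x) + (LINT x|D. p x))"
      using nn_integral_le_add_measure[OF sets MN, of "\<lambda>x. ennreal (p x)"] pq
      by (simp add: nn_integral_eq_integral iM iN iD integral_nonneg_AE)
    then show ?thesis
      using pq by (subst (asm) ennreal_le_iff) (auto intro!: add_nonneg_nonneg integral_nonneg_AE)
  qed
  have 2: "(LINT x|N. q x) \<le> (LINT x|M. q x) + (LINT x|D. q x)"
  proof -
    have "ennreal (LINT x|N. q x) \<le> ennreal ((LINT x|M. q x) + (LINT x|D. q x))"
      using nn_integral_le_add_measure[of M N D "\<lambda>x. ennreal (q x)"] sets NM pq
      by (simp add: nn_integral_eq_integral iM iN iD integral_nonneg_AE)
    then show ?thesis
      using pq by (subst (asm) ennreal_le_iff) (auto intro!: add_nonneg_nonneg integral_nonneg_AE)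
  qed
  have "(LINT x|M. v x) - (LINT x|N. v x) = ((LINT x|M. p x) - (LINT x|N. p x)) + ((LINT x|N. q x) - (LINT x|M. q x))"
    by (simp add: pq(1) iM iN)
  also have "\<dots> \<le> (LINT x|D. p x + q x)"
    using 1 2 iD by simp
  also have "\<dots> \<le> (LINT x|D. w x)"
    using iD w vw by (intro integral_mono) (auto simp: pq)
  finally show ?thesis .
qed

lemma cis_minus_Arg_mult: "cis (- Arg z) * z = complex_of_real (cmod z)"
proof -
  have "cis (- Arg z) * z = cis (- Arg z) * (complex_of_real (cmod z) * cis (Arg z))"
    using rcis_cmod_Arg[of z] by (simp add: rcis_def)
  also have "\<dots> = complex_of_real (cmod z)"
    by (simp add: cis_mult mult.left_commute)
  finally show ?thesis .
qed

text \<open>Rotating by the argument of the difference makes it real and nonnegative. This reduces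
  the claim to the real case without the constant that separate estimates of real and imaginary
  parts would cost.\<close>

lemma cmod_integral_diff_le_add_measure:
  fixes u :: "'a \<Rightarrow> complex" and w :: "'a \<Rightarrow> real"
  assumes sets: "sets N = sets M" "sets D = sets M"
    and MN: "\<And>A. A \<in> sets M \<Longrightarrow> emeasure M A \<le> emeasure N A + emeasure D A"
    and NM: "\<And>A. A \<in> sets M \<Longrightarrow> emeasure N A \<le> emeasure M A + emeasure D A"
    and u: "integrable M u" "integrable N u" and w: "integrable D w"
    and uw: "\<And>x. cmod (u x) \<le> w x"
  shows "cmod ((CLINT x|M. u x) - (CLINT x|N. u x)) \<le> (LINT x|D. w x)"
proof -
  define z where "z = (CLINT x|M. u x) - (CLINT x|N. u x)"
  define r where "r = cis (- Arg z)"
  have r: "cmod r = 1"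
    by (simp add: r_def)
  have "cmod z = Re (r * z)"
    unfolding r_def cis_minus_Arg_mult by simp
  also have "r * z = (CLINT x|M. r * u x) - (CLINT x|N. r * u x)"
    using u by (simp add: z_def right_diff_distrib)
  also have "Re \<dots> = (LINT x|M. Re (r * u x)) - (LINT x|N. Re (r * u x))"
    using u by (simp add: integral_Re integrable_mult_right del: times_complex.sel)
  also have "\<dots> \<le> (LINT x|D. w x)"
  proof (rule integral_diff_le_add_measure[OF sets MN NM _ _ w])
    show "\<bar>Re (r * u x)\<bar> \<le> w x" for x
      using order_trans[OF abs_Re_le_cmod, of "r * u x" "w x"] uw[of x] by (simp add: norm_mult r del: times_complex.sel)
  qed (use u in \<open>auto simp del: times_complex.sel intro!: integrable_Re\<close>)
  finally show ?thesis
    by (simp add: z_def)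
qed

subsection \<open>Comparison of the characteristic functions near the origin\<close>

lemma sets_laws [simp, measurable_cong]:
  "sets (scaled_law L \<sigma>) = sets borel" "sets std_normal_law = sets borel" "sets (abs_dH L \<sigma>) = sets borel"
  by (simp_all add: scaled_law_def std_normal_law_def abs_dH_def)

lemma abs_dH_le_emeasure_abs_dH:
  assumes "prob_space L" "sets L = sets borel" "A \<in> sets borel"
  shows "ennreal \<bar>dH L \<sigma> A\<bar> \<le> emeasure (abs_dH L \<sigma>) A"
proof -
  have "(\<Sum>B\<in>{A}. ennreal \<bar>dH L \<sigma> B\<bar>) \<le> variation borel (dH L \<sigma>) A"
    unfolding variation_def by (rule SUP_upper) (use assms in auto)
  then show ?thesis
    using emeasure_abs_dH[OF assms, of \<sigma>] by simp
qed

context real_distribution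
begin

lemma prob_space_scaled_law: "prob_space (scaled_law M \<sigma>)"
  unfolding scaled_law_def by (rule prob_space_distr) simp

lemma emeasure_laws_le:
  assumes "A \<in> sets borel"
  shows "emeasure (scaled_law M \<sigma>) A \<le> emeasure std_normal_law A + emeasure (abs_dH M \<sigma>) A"
    and "emeasure std_normal_law A \<le> emeasure (scaled_law M \<sigma>) A + emeasure (abs_dH M \<sigma>) A"
proof -
  interpret S: prob_space "scaled_law M \<sigma>" by (rule prob_space_scaled_law)
  interpret N: prob_space std_normal_law by (rule prob_space_std_normal_law)
  have D: "ennreal \<bar>dH M \<sigma> A\<bar> \<le> emeasure (abs_dH M \<sigma>) A"
    by (rule abs_dH_le_emeasure_abs_dH) (use assms prob_space_axioms in auto)
  have "emeasure (scaled_law M \<sigma>) A \<le> emeasure std_normal_law A + ennreal \<bar>dH M \<sigma> A\<bar>"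
    unfolding S.emeasure_eq_measure N.emeasure_eq_measure dH_def
    by (subst ennreal_plus[symmetric]) (auto intro!: ennreal_leI simp del: ennreal_plus)
  also have "\<dots> \<le> emeasure std_normal_law A + emeasure (abs_dH M \<sigma>) A"
    using D by (rule add_left_mono)
  finally show "emeasure (scaled_law M \<sigma>) A \<le> emeasure std_normal_law A + emeasure (abs_dH M \<sigma>) A" .
  have "emeasure std_normal_law A \<le> emeasure (scaled_law M \<sigma>) A + ennreal \<bar>dH M \<sigma> A\<bar>"
    unfolding S.emeasure_eq_measure N.emeasure_eq_measure dH_def
    by (subst ennreal_plus[symmetric]) (auto intro!: ennreal_leI simp del: ennreal_plus)
  also have "\<dots> \<le> emeasure (scaled_law M \<sigma>) A + emeasure (abs_dH M \<sigma>) A"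
    using D by (rule add_left_mono)
  finally show "emeasure std_normal_law A \<le> emeasure (scaled_law M \<sigma>) A + emeasure (abs_dH M \<sigma>) A" .
qed

lemma char_scaled_law: "char (scaled_law M \<sigma>) s = char M (s / \<sigma>)"
  unfolding char_def scaled_law_def by (subst integral_distr) auto

end

lemma integrable_std_normal_law_power: "integrable std_normal_law (\<lambda>x. x ^ k)"
  unfolding std_normal_law_def by (rule integrable_std_normal_distribution_moment)

lemma char_std_normal_law: "char std_normal_law s = exp (- (s\<^sup>2) / 2)"
  unfolding std_normal_law_def char_std_normal_distribution by (simp add: exp_of_real)

text \<open>
  The moments of orders up to \<open>m\<close> of the two laws agree, so the Taylor polynomial of \<open>iexp\<close> can be
  subtracted for free.
\<close>

lemma (in real_distribution) cmod_char_diff_le: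
  assumes \<sigma>: "\<sigma> > 0" and m: "m \<ge> 3"
    and sq: "integrable M (\<lambda>x. x\<^sup>2)" and mean: "(LINT x|M. x) = 0" and var: "(LINT x|M. x\<^sup>2) = \<sigma>\<^sup>2"
    and exists: "pseudomoment_exists M \<sigma> m"
    and zero: "\<And>k. k \<in> {3..m} \<Longrightarrow> pseudomoment M \<sigma> k = 0"
  shows "cmod (char M (s / \<sigma>) - exp (- (s\<^sup>2) / 2))
    \<le> \<bar>s\<bar> ^ (m + 1) / fact (m + 1) * nu1 M \<sigma> n m + 2 * \<bar>s\<bar> ^ m / fact m * nu2 M \<sigma> n m"
proof -
  let ?S = "scaled_law M \<sigma>" and ?N = std_normal_law and ?D = "abs_dH M \<sigma>"
  define T where "T = \<sigma> * sqrt (real n)"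
  have "0 \<le> T"
    using \<sigma> by (simp add: T_def)
  interpret S: prob_space ?S by (rule prob_space_scaled_law)
  interpret N: prob_space ?N by (rule prob_space_std_normal_law)
  have Dm: "integrable ?D (\<lambda>x. \<bar>x\<bar> ^ m)"
    using integrable_abs[OF exists[unfolded pseudomoment_exists_def]] by (simp add: power_abs)
  have Nm: "integrable ?N (\<lambda>x. \<bar>x\<bar> ^ m)"
    using integrable_abs[OF integrable_std_normal_law_power[of m]] by (simp add: power_abs)
  \<comment> \<open>Existence of the pseudomoment is a statement about |dH|. The law of the scaled
    summand is dominated by the normal law plus |dH| and so inherits the absolute moment.\<close>
  have Sm: "integrable ?S (\<lambda>x. \<bar>x\<bar> ^ m)"
  proof (rule integrableI_bounded)
    have "(\<integral>\<^sup>+x. ennreal (norm (\<bar>x\<bar> ^ m)) \<partial>?S)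
        \<le> (\<integral>\<^sup>+x. ennreal (norm (\<bar>x\<bar> ^ m)) \<partial>?N) + (\<integral>\<^sup>+x. ennreal (norm (\<bar>x\<bar> ^ m)) \<partial>?D)"
      by (rule nn_integral_le_add_measure) (auto intro: emeasure_laws_le)
    also have "\<dots> < \<infinity>"
      using Nm Dm unfolding integrable_iff_bounded by (simp add: ennreal_add_less_top)
    finally show "(\<integral>\<^sup>+x. ennreal (norm (\<bar>x\<bar> ^ m)) \<partial>?S) < \<infinity>" .
  qed simp
  have Sk: "integrable ?S (\<lambda>x. x ^ k)" if "k \<le> m" for k
  proof (rule Bochner_Integration.integrable_bound)
    show "integrable ?S (\<lambda>x. 1 + \<bar>x\<bar> ^ m)"
      using Sm by simp
    have "\<bar>x\<bar> ^ k \<le> 1 + \<bar>x\<bar> ^ m" for x :: real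
    proof (cases "\<bar>x\<bar> \<le> 1")
      case True
      then have "\<bar>x\<bar> ^ k \<le> 1" by (simp add: power_le_one)
      then show ?thesis by (simp add: add_increasing2)
    next
      case False
      then show ?thesis using power_increasing[OF that, of "\<bar>x\<bar>"] by linarith
    qed
    then show "AE x in ?S. norm (x ^ k) \<le> norm (1 + \<bar>x\<bar> ^ m)"
      by (simp add: power_abs)
  qed simp
  have moments: "(LINT x|?S. x ^ k) = (LINT x|?N. x ^ k)" if "k \<le> m" for k
  proof -
    \<comment> \<open>Total mass, centring and scaling by \<sigma> settle the orders 0, 1, 2; the
      pseudomoments settle the others.\<close>
    consider "k = 0" | "k = 1" | "k = 2" | "k \<in> {3..m}"
      using \<open>k \<le> m\<close> unfolding atLeastAtMost_iff by linarith
    then show ?thesis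
    proof cases
      case 1
      then show ?thesis
        using S.prob_space N.prob_space by simp
    next
      case 2
      have "(LINT x|?S. x) = (LINT x|M. x / \<sigma>)"
        unfolding scaled_law_def by (rule integral_distr) auto
      moreover have "(LINT x|?N. x ^ 1) = 0"
        unfolding std_normal_law_def by (rule integral_std_normal_distribution_moment_odd) simp
      ultimately show ?thesis
        using 2 mean by simp
    next
      case 3
      have "(LINT x|?S. x\<^sup>2) = (LINT x|M. (x / \<sigma>)\<^sup>2)"
        unfolding scaled_law_def by (rule integral_distr) auto
      moreover have "(LINT x|?N. x ^ (2 * 1)) = fact (2 * 1) / (2 ^ 1 * fact 1)"
        unfolding std_normal_law_def by (rule std_normal_distribution_even_moments)
      ultimately show ?thesis
        using 3 var \<sigma> by (simp add: power_divide)
    next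
      case 4
      then show ?thesis
        using zero[of k] by (simp add: pseudomoment_def)
    qed
  qed
  define u where "u x = iexp (s * x) - (\<Sum>k\<le>m. (\<i> * complex_of_real (s * x)) ^ k / fact k)" for x
  have taylor: "(CLINT x|Q. u x) = char Q s - (\<Sum>k\<le>m. (\<i> * s) ^ k / fact k * (LINT x|Q. x ^ k))"
    and int_u: "integrable Q u"
    if Q: "prob_space Q" "sets Q = sets borel" "\<And>k. k \<le> m \<Longrightarrow> integrable Q (\<lambda>x. x ^ k)" for Q
  proof -
    interpret Q: prob_space Q by fact
    note [measurable_cong] = Q(2)
    have 1: "integrable Q (\<lambda>x. iexp (s * x))"
      by (rule Q.integrable_iexp) auto
    have 2: "integrable Q (\<lambda>x. (\<i> * s) ^ k / fact k * complex_of_real (x ^ k))" if "k \<le> m" for k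
      by (intro integrable_mult_right integrable_of_real Q(3) that)
    have u: "u x = iexp (s * x) - (\<Sum>k\<le>m. (\<i> * s) ^ k / fact k * complex_of_real (x ^ k))" for x
      by (simp add: u_def power_mult_distrib mult.assoc)
    show "integrable Q u"
      unfolding u[abs_def] using 1 2
      by (intro Bochner_Integration.integrable_diff Bochner_Integration.integrable_sum) auto
    show "(CLINT x|Q. u x) = char Q s - (\<Sum>k\<le>m. (\<i> * s) ^ k / fact k * (LINT x|Q. x ^ k))"
      unfolding u char_def using 1 2
      by (subst Bochner_Integration.integral_diff)
        (auto simp del: of_real_power simp: Bochner_Integration.integral_sum intro!: Bochner_Integration.integrable_sum)
  qed
  \<comment> \<open>Of the two bounds for the Taylor remainder, the one of order
    \<open>m + 1\<close> serves up to the truncation level and the one of order \<open>m\<close>,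
    with its factor 2, beyond it, where higher moments may be infinite.\<close>
  define w where "w x = \<bar>s\<bar> ^ (m + 1) / fact (m + 1) * (indicator {x. \<bar>x\<bar> \<le> T} x * \<bar>x\<bar> ^ (m + 1))
      + 2 * \<bar>s\<bar> ^ m / fact m * (indicator {x. \<bar>x\<bar> > T} x * \<bar>x\<bar> ^ m)" for x
  \<comment> \<open>Below the truncation level the extra factor |x| is at most \<open>T\<close>, so
    the moment of order \<open>m\<close> suffices.\<close>
  have i1: "integrable ?D (\<lambda>x. indicator {x. \<bar>x\<bar> \<le> T} x * \<bar>x\<bar> ^ (m + 1))"
    by (rule Bochner_Integration.integrable_bound[OF integrable_mult_right[OF Dm, of T]])
      (use \<open>0 \<le> T\<close> in \<open>auto simp: indicator_def abs_mult intro!: mult_right_mono\<close>)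
  have i2: "integrable ?D (\<lambda>x. indicator {x. \<bar>x\<bar> > T} x * \<bar>x\<bar> ^ m)"
    by (rule Bochner_Integration.integrable_bound[OF Dm]) (auto simp: indicator_def)
  have "cmod (u x) \<le> w x" for x
  proof (cases "\<bar>x\<bar> \<le> T")
    case True
    then show ?thesis
      using iexp_approx1[of "s * x" m]
      by (simp add: u_def w_def indicator_def abs_mult power_mult_distrib mult_ac)
  next
    case False
    then show ?thesis
      using iexp_approx2[of "s * x" m]
      by (simp add: u_def w_def indicator_def abs_mult power_mult_distrib mult_ac)
  qed
  then have "cmod ((CLINT x|?S. u x) - (CLINT x|?N. u x)) \<le> (LINT x|?D. w x)"
    unfolding w_def using i1 i2
    by (intro cmod_integral_diff_le_add_measure int_u emeasure_laws_le)
      (auto intro: Sk integrable_std_normal_law_power S.prob_space_axioms N.prob_space_axioms)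
  also have "(CLINT x|?S. u x) - (CLINT x|?N. u x) = char ?S s - char ?N s"
    by (simp add: taylor S.prob_space_axioms N.prob_space_axioms Sk integrable_std_normal_law_power moments)
  also have "(LINT x|?D. w x) = \<bar>s\<bar> ^ (m + 1) / fact (m + 1) * nu1 M \<sigma> n m + 2 * \<bar>s\<bar> ^ m / fact m * nu2 M \<sigma> n m"
    unfolding w_def nu1_def nu2_def set_lebesgue_integral_def T_def[symmetric] real_scaleR_def
    by (subst Bochner_Integration.integral_add) (use i1 i2 in \<open>auto simp del: power_Suc fact_Suc\<close>)
  finally show ?thesis
    by (simp add: char_scaled_law char_std_normal_law)
qed

subsection \<open>Characteristic functions of bounded densities\<close>

text \<open>The sine is concave on [0, pi/2] and hence lies above its chord.\<close>

lemma Jordan_sin_ge: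
  fixes x :: real
  assumes "0 \<le> x" "x \<le> pi / 2"
  shows "2 / pi * x \<le> sin x"
proof -
  have "convex_on {0..pi / 2} (\<lambda>x. - sin x)"
  proof (rule convex_on_realI)
    show "((\<lambda>x. - sin x) has_real_derivative - cos x) (at x)" for x
      by (auto intro!: derivative_eq_intros)
    show "- cos x \<le> - cos y" if "x \<in> {0..pi / 2}" "y \<in> {0..pi / 2}" "x \<le> y" for x y
      using cos_monotone_0_pi_le[of x y] that by auto
  qed auto
  then have "- sin ((1 - 2 * x / pi) *\<^sub>R 0 + (2 * x / pi) *\<^sub>R (pi / 2))
      \<le> (1 - 2 * x / pi) * (- sin 0) + 2 * x / pi * (- sin (pi / 2))"
    by (rule convex_onD) (use assms in \<open>auto simp: field_simps\<close>)
  then show ?thesis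
    by simp
qed

text \<open>Shifting by the nearest multiple of pi changes the sine by at most a sign and brings the
  argument into [-pi/2, pi/2], where Jordan's inequality applies.\<close>

lemma abs_sin_ge_dist_round:
  fixes v :: real
  defines "k \<equiv> round (v / pi)"
  shows "2 / pi * \<bar>v - of_int k * pi\<bar> \<le> \<bar>sin v\<bar>"
proof -
  define w where "w = v - of_int k * pi"
  have "\<bar>of_int k - v / pi\<bar> \<le> 1 / 2"
    unfolding k_def by (rule of_int_round_abs_le)
  then have "\<bar>of_int k - v / pi\<bar> * pi \<le> 1 / 2 * pi"
    by (rule mult_right_mono) simp
  also have "\<bar>of_int k - v / pi\<bar> * pi = \<bar>(of_int k - v / pi) * pi\<bar>"
    by (simp add: abs_mult)
  also have "(of_int k - v / pi) * pi = - w"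
    by (simp add: w_def left_diff_distrib)
  finally have w: "\<bar>w\<bar> \<le> pi / 2" by simp
  have kpi: "sin (of_int k * pi) = 0"
    using sin_npi_int[of k] by (simp add: mult.commute)
  have "sin v = sin (w + of_int k * pi)"
    by (simp add: w_def)
  also have "\<dots> = sin w * cos (of_int k * pi)"
    using kpi by (simp add: sin_add)
  finally have "\<bar>sin v\<bar> = \<bar>sin w\<bar>"
    using kpi by (simp add: abs_mult sin_zero_abs_cos_one)
  moreover have "\<bar>sin w\<bar> = sin \<bar>w\<bar>"
    using w sin_ge_zero[of "\<bar>w\<bar>"] by (cases "0 \<le> w") (auto simp: abs_if)
  ultimately show ?thesis
    using Jordan_sin_ge[of "\<bar>w\<bar>"] w by (simp add: w_def)
qed

text \<open>After a rotation the modulus is a real integral, so \<open>1 - cmod (char M t)\<close>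
  is the integral of a nonnegative function.\<close>

lemma (in real_distribution) cmod_char_eq_integral_cos:
  "cmod (char M t) = (LINT x|M. cos (t * x - Arg (char M t)))"
proof -
  define z where "z = char M t"
  define r where "r = cis (- Arg z)"
  have "cmod z = Re (r * z)"
    unfolding r_def cis_minus_Arg_mult by simp
  also have int: "integrable M (\<lambda>x. iexp (t * x))"
    by (rule integrable_iexp) auto
  then have "r * z = (CLINT x|M. r * iexp (t * x))"
    by (simp add: z_def char_def)
  also have "Re \<dots> = (LINT x|M. Re (r * iexp (t * x)))"
    using int by (simp add: integral_Re integrable_mult_right del: times_complex.sel)
  also have "\<dots> = (LINT x|M. cos (t * x - Arg z))"
    by (intro Bochner_Integration.integral_cong refl)
      (simp add: r_def cis_conv_exp flip: exp_add, simp add: Re_exp algebra_simps)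
  finally show ?thesis
    by (simp add: z_def)
qed

lemma measure_interval_le_of_density_le:
  assumes "is_continuous_density M p" and p: "\<And>x. p x \<le> a" and "u \<le> v"
  shows "measure M {u..v} \<le> a * (v - u)"
proof -
  have M: "M = density lborel (\<lambda>x. ennreal (p x))" and "continuous_on UNIV p" and nonneg: "\<And>x. 0 \<le> p x"
    using assms(1) by (auto simp: is_continuous_density_def)
  then have [measurable]: "p \<in> borel_measurable borel"
    by (intro borel_measurable_continuous_onI)
  have "0 \<le> a"
    using nonneg p order_trans by blast
  have "emeasure M {u..v} = (\<integral>\<^sup>+x. ennreal (p x) * indicator {u..v} x \<partial>lborel)"
    unfolding M by (subst emeasure_density) auto
  also have "\<dots> \<le> (\<integral>\<^sup>+x. ennreal a * indicator {u..v} x \<partial>lborel)"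
    by (intro nn_integral_mono mult_right_mono ennreal_leI p) auto
  also have "\<dots> = ennreal (a * (v - u))"
    using \<open>0 \<le> a\<close> \<open>u \<le> v\<close> by (simp add: nn_integral_cmult_indicator ennreal_mult)
  finally show ?thesis
    using \<open>0 \<le> a\<close> \<open>u \<le> v\<close> by (simp add: measure_def enn2real_leI)
qed

text \<open>
  Since \<open>1 - \<bar>f(t)\<bar> = 2 E sin\<^sup>2((t X - \<theta>) / 2)\<close>, the mass that \<open>X\<close> puts away from the zeros of the sine
  counts. By Chebyshev at least \<open>3/4\<close> of the mass is in \<open>[-2 \<sigma>, 2 \<sigma>]\<close>, and at most half of the mass
  is within \<open>2 d / t\<close> of one of the at most \<open>N\<close> zeros there.
\<close>

lemma (in real_distribution) cmod_char_le_exp_of_density_le: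
  assumes dens: "is_continuous_density M p" and p: "\<And>x. p x \<le> a" and a: "0 < a"
    and \<sigma>: "\<sigma> > 0" and sq: "integrable M (\<lambda>x. x\<^sup>2)" and mean: "(LINT x|M. x) = 0" and var: "(LINT x|M. x\<^sup>2) = \<sigma>\<^sup>2"
    and t: "t \<noteq> 0"
  shows "cmod (char M t) \<le> exp (- (t\<^sup>2 / (128 * a\<^sup>2 * (\<sigma> * \<bar>t\<bar> + pi)\<^sup>2)))"
proof -
  define \<theta> where "\<theta> = Arg (char M t)"
  \<comment> \<open>\<open>N\<close> bounds the number of relevant zeros: v / pi ranges over an
    interval of length \<open>2 * \<sigma> * \<bar>t\<bar> / pi\<close>, rounding extends it by 1/2
    on either side, and an interval of length l holds at most l + 1 integers.\<close>
  define N where "N = 2 * \<sigma> * \<bar>t\<bar> / pi + 2"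
  \<comment> \<open>Chosen so that \<open>N\<close> intervals of length
    \<open>4 * d / \<bar>t\<bar>\<close>, each of mass at most \<open>a\<close> times its length,
    have total mass at most 1/2.\<close>
  define d where "d = \<bar>t\<bar> / (8 * a * N)"
  have "0 < N"
    unfolding N_def using \<sigma> by (intro add_nonneg_pos) auto
  then have "0 < d"
    using a t by (simp add: d_def)
  define c where "c = (2 / pi * d)\<^sup>2"
  define \<alpha> \<beta> where "\<alpha> = (- 2 * \<sigma> * \<bar>t\<bar> - \<theta>) / (2 * pi)" and "\<beta> = (2 * \<sigma> * \<bar>t\<bar> - \<theta>) / (2 * pi)"
  define K where "K = {\<lceil>\<alpha> - 1 / 2\<rceil>..\<lfloor>\<beta> + 1 / 2\<rfloor>}"
  \<comment> \<open>The centres are the zeros of sin((t x - \<theta>) / 2); a distance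
    \<open>d\<close> in the half angle is a distance \<open>2 * d / \<bar>t\<bar>\<close> in
    \<open>x\<close>.\<close>
  define I where "I k = {(\<theta> + 2 * pi * of_int k) / t - 2 * d / \<bar>t\<bar>..(\<theta> + 2 * pi * of_int k) / t + 2 * d / \<bar>t\<bar>}" for k :: int
  define B where "B = {x. \<bar>x\<bar> < 2 * \<sigma> \<and> (sin ((t * x - \<theta>) / 2))\<^sup>2 < c}"
  define G where "G = {x. \<bar>x\<bar> < 2 * \<sigma> \<and> c \<le> (sin ((t * x - \<theta>) / 2))\<^sup>2}"
  have [measurable]: "B \<in> sets borel" "G \<in> sets borel"
    unfolding B_def G_def by measurable
  have "B \<subseteq> (\<Union>k\<in>K. I k)"
  proof
    fix x assume x: "x \<in> B"
    define v where "v = (t * x - \<theta>) / 2"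
    define k where "k = round (v / pi)"
    have "\<bar>t * x\<bar> \<le> 2 * \<sigma> * \<bar>t\<bar>"
      using x by (auto simp: B_def abs_mult mult.commute intro!: mult_left_mono)
    then have "\<alpha> \<le> v / pi" "v / pi \<le> \<beta>"
      by (auto simp: \<alpha>_def \<beta>_def v_def divide_simps)
    moreover have "\<bar>of_int k - v / pi\<bar> \<le> 1 / 2"
      unfolding k_def by (rule of_int_round_abs_le)
    ultimately have "\<alpha> - 1 / 2 \<le> of_int k" "of_int k \<le> \<beta> + 1 / 2"
      by linarith+
    then have "k \<in> K"
      by (simp add: K_def ceiling_le_iff le_floor_iff)
    have "\<bar>sin v\<bar>\<^sup>2 < (2 / pi * d)\<^sup>2"
      using x by (simp add: B_def c_def v_def)
    then have "\<bar>sin v\<bar> < 2 / pi * d"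
      by (rule power2_less_imp_less) (use \<open>0 < d\<close> in simp)
    with abs_sin_ge_dist_round[of v] have "2 / pi * \<bar>v - of_int k * pi\<bar> < 2 / pi * d"
      unfolding k_def by linarith
    then have "\<bar>v - of_int k * pi\<bar> < d"
      by (subst (asm) mult_less_cancel_left_pos) auto
    then have "\<bar>t * x - (\<theta> + 2 * pi * of_int k)\<bar> \<le> 2 * d"
      by (auto simp: v_def abs_if field_simps split: if_splits)
    also have "t * x - (\<theta> + 2 * pi * of_int k) = t * (x - (\<theta> + 2 * pi * of_int k) / t)"
      using t by (simp add: right_diff_distrib)
    finally have "\<bar>x - (\<theta> + 2 * pi * of_int k) / t\<bar> \<le> 2 * d / \<bar>t\<bar>"
      using t by (simp add: abs_mult pos_le_divide_eq mult.commute)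
    then have "x \<in> I k"
      unfolding I_def by (auto simp: abs_le_iff)
    with \<open>k \<in> K\<close> show "x \<in> (\<Union>k\<in>K. I k)" by blast
  qed
  then have "measure M B \<le> measure M (\<Union>k\<in>K. I k)"
    by (intro finite_measure_mono sets.finite_UN) (auto simp: K_def I_def)
  also have "\<dots> \<le> (\<Sum>k\<in>K. measure M (I k))"
    by (rule measure_UNION_le) (auto simp: K_def I_def)
  also have "\<dots> \<le> (\<Sum>k\<in>K. a * (4 * d / \<bar>t\<bar>))"
  proof (rule sum_mono)
    fix k
    show "measure M (I k) \<le> a * (4 * d / \<bar>t\<bar>)"
      unfolding I_def using \<open>0 < d\<close> by (intro order_trans[OF measure_interval_le_of_density_le[OF dens p]]) auto
  qed
  also have "\<dots> = real (card K) * (a * (4 * d / \<bar>t\<bar>))"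
    by simp
  also have "real (card K) \<le> N"
  proof -
    have "\<beta> - \<alpha> = 2 * \<sigma> * \<bar>t\<bar> / pi"
      by (simp add: \<alpha>_def \<beta>_def field_simps)
    then have "of_int (\<lfloor>\<beta> + 1 / 2\<rfloor> - \<lceil>\<alpha> - 1 / 2\<rceil> + 1) \<le> N"
      unfolding N_def using of_int_floor_le[of "\<beta> + 1 / 2"] le_of_int_ceiling[of "\<alpha> - 1 / 2"] by simp linarith
    then show ?thesis
      using \<open>0 < N\<close> by (cases "0 \<le> \<lfloor>\<beta> + 1 / 2\<rfloor> - \<lceil>\<alpha> - 1 / 2\<rceil> + 1") (simp_all add: K_def)
  qed
  then have "real (card K) * (a * (4 * d / \<bar>t\<bar>)) \<le> N * (a * (4 * d / \<bar>t\<bar>))"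
    by (rule mult_right_mono) (use a \<open>0 < d\<close> in simp)
  also have "\<dots> = 1 / 2"
    unfolding d_def using a t \<open>0 < N\<close> by simp
  finally have MB: "measure M B \<le> 1 / 2" by simp
  have "3 / 4 \<le> measure M {x. \<bar>x\<bar> < 2 * \<sigma>}"
  proof -
    have "measure M {x \<in> space M. 2 * \<sigma> \<le> \<bar>x - expectation (\<lambda>x. x)\<bar>} \<le> variance (\<lambda>x. x) / (2 * \<sigma>)\<^sup>2"
      by (rule Chebyshev_inequality) (use sq \<sigma> in auto)
    then have "measure M {x. 2 * \<sigma> \<le> \<bar>x\<bar>} \<le> 1 / 4"
      using mean var \<sigma> by (simp add: power_mult_distrib)
    moreover have "measure M {x. \<bar>x\<bar> < 2 * \<sigma>} = 1 - measure M {x. 2 * \<sigma> \<le> \<bar>x\<bar>}"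
      by (subst prob_compl[symmetric]) (auto intro!: arg_cong[where f=prob])
    ultimately show ?thesis by simp
  qed
  also have "{x. \<bar>x\<bar> < 2 * \<sigma>} = B \<union> G"
    by (auto simp: B_def G_def)
  also have "measure M (B \<union> G) \<le> measure M B + measure M G"
    by (rule measure_Un_le) auto
  finally have MG: "1 / 4 \<le> measure M G"
    using MB by simp
  have half_angle: "cos w = 1 - 2 * (sin (w / 2))\<^sup>2" for w :: real
    using cos_double_sin[of "w / 2"] by simp
  \<comment> \<open>At least 3/4 - 1/2 of the mass lies in \<open>G\<close>, where
    \<open>1 - cos (t * x - \<theta>)\<close> is at least \<open>2 * c\<close>.\<close>
  have "2 * c * (1 / 4) \<le> 2 * c * measure M G"
    using MG by (intro mult_left_mono) (auto simp: c_def)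
  also have "\<dots> = (LINT x|M. 2 * c * indicator G x)"
    by simp
  also have "\<dots> \<le> (LINT x|M. 1 - cos (t * x - \<theta>))"
  proof (rule integral_mono)
    show "integrable M (\<lambda>x. 1 - cos (t * x - \<theta>))"
      by (rule integrable_const_bound[where B=2]) (auto intro!: AE_I2 order_trans[OF abs_triangle_ineq4] abs_cos_le_one)
    show "2 * c * indicator G x \<le> 1 - cos (t * x - \<theta>)" for x
      using half_angle[of "t * x - \<theta>"] by (auto simp: G_def indicator_def)
  qed (auto intro!: integrable_real_indicator simp: emeasure_eq_measure)
  also have "\<dots> = 1 - cmod (char M t)"
    unfolding cmod_char_eq_integral_cos[of t] \<theta>_def
    by (subst Bochner_Integration.integral_diff) (use prob_space in \<open>auto intro!: integrable_const_bound[where B=1]\<close>)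
  finally have "cmod (char M t) \<le> 1 + - (c / 2)"
    by simp
  also have "\<dots> \<le> exp (- (c / 2))"
    by (rule exp_ge_add_one_self)
  also have "c / 2 = t\<^sup>2 / (128 * a\<^sup>2 * (\<sigma> * \<bar>t\<bar> + pi)\<^sup>2)"
  proof -
    have pN: "pi * N = 2 * (\<sigma> * \<bar>t\<bar> + pi)"
      by (simp add: N_def field_simps)
    have "c / 2 = t\<^sup>2 / (32 * a\<^sup>2 * (pi * N)\<^sup>2)"
      by (simp add: c_def d_def power_mult_distrib power_divide)
    also have "\<dots> = t\<^sup>2 / (128 * a\<^sup>2 * (\<sigma> * \<bar>t\<bar> + pi)\<^sup>2)"
      unfolding pN power_mult_distrib by simp
    finally show ?thesis .
  qed
  finally show ?thesis .
qed

text \<open>The inversion formula bounds the density by \<open>A / (2 * pi)\<close>, so the previous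
  estimate applies. Its exponent depends on s = \<sigma> |t| through s / (s + pi), which increases;
  hence s = 1 is the worst case.\<close>

lemma (in real_distribution) cmod_char_le_b_const:
  assumes int: "integrable lborel (\<lambda>t. cmod (char M t))"
    and \<sigma>: "\<sigma> > 0" and sq: "integrable M (\<lambda>x. x\<^sup>2)" and mean: "(LINT x|M. x) = 0" and var: "(LINT x|M. x\<^sup>2) = \<sigma>\<^sup>2"
  defines "A \<equiv> (LBINT t. cmod (char M t))"
  shows "0 < A" and "1 \<le> \<sigma> * \<bar>t\<bar> \<Longrightarrow> cmod (char M t) \<le> b_const A \<sigma>"
proof -
  let ?p = "\<lambda>x. Re (inverse_char (char M) x)"
  have dens: "is_continuous_density M ?p"
    by (rule is_continuous_density_inverse_char[OF int])
  have p: "?p x \<le> A / (2 * pi)" for x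
    unfolding A_def by (rule order_trans[OF complex_Re_le_cmod cmod_inverse_char_le[OF char_measurable int]])
  have "0 \<le> A"
    by (simp add: A_def)
  \<comment> \<open>For \<open>A = 0\<close> the density would vanish identically, and with it the
    probability measure.\<close>
  moreover have "A \<noteq> 0"
  proof
    assume "A = 0"
    then have "?p x = 0" for x
      using dens p[of x] by (auto simp: is_continuous_density_def intro: antisym)
    then have "M = density lborel (\<lambda>_. 0)"
      using dens by (simp add: is_continuous_density_def)
    then have "emeasure M (space M) = 0"
      by (metis emeasure_density_const mult_zero_left sets.top space_density sets_density)
    then show False
      using emeasure_space_1 by simp
  qed
  ultimately show "0 < A" by simp
  assume t: "1 \<le> \<sigma> * \<bar>t\<bar>"
  define s where "s = \<sigma> * \<bar>t\<bar>"
  have "cmod (char M t) \<le> exp (- (t\<^sup>2 / (128 * (A / (2 * pi))\<^sup>2 * (s + pi)\<^sup>2)))"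
    unfolding s_def using t \<open>0 < A\<close> by (intro cmod_char_le_exp_of_density_le[OF dens p _ \<sigma> sq mean var]) auto
  also have "\<dots> \<le> b_const A \<sigma>"
  proof -
    have "1 \<le> s"
      using t by (simp add: s_def)
    \<comment> \<open>The difference of the two sides is
      \<open>64 + 8 * pi * (4 - pi)\<close>.\<close>
    have *: "32 * (1 + pi)\<^sup>2 \<le> 24 * (2 + pi)\<^sup>2"
    proof -
      define z where "z = pi * (4 - pi)"
      have "0 \<le> z"
        unfolding z_def using pi_less_4 by (intro mult_nonneg_nonneg) auto
      moreover have "32 * (1 + pi)\<^sup>2 = 24 * (2 + pi)\<^sup>2 - (64 + 8 * z)"
        by (simp add: z_def power2_eq_square algebra_simps)
      ultimately show ?thesis
        by simp
    qed
    have "32 * (s + pi)\<^sup>2 \<le> 32 * (s * (1 + pi))\<^sup>2"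
      using \<open>1 \<le> s\<close> by (intro mult_left_mono power_mono) (auto simp: distrib_left mult_le_cancel_right1)
    also have "\<dots> \<le> s\<^sup>2 * (24 * (2 + pi)\<^sup>2)"
      using mult_left_mono[OF *, of "s\<^sup>2"] by (simp add: power_mult_distrib)
    also have "s\<^sup>2 = \<sigma>\<^sup>2 * t\<^sup>2"
      by (simp add: s_def power_mult_distrib)
    finally have "32 * (s + pi)\<^sup>2 \<le> \<sigma>\<^sup>2 * t\<^sup>2 * (24 * (2 + pi)\<^sup>2)" .
    then have "32 * (s + pi)\<^sup>2 * (A\<^sup>2 * pi\<^sup>2) \<le> \<sigma>\<^sup>2 * t\<^sup>2 * (24 * (2 + pi)\<^sup>2) * (A\<^sup>2 * pi\<^sup>2)"
      by (rule mult_right_mono) simp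
    moreover have "0 < s + pi" "0 < 2 + pi"
      using \<open>1 \<le> s\<close> pi_gt_zero by linarith+
    ultimately have "pi\<^sup>2 / (24 * A\<^sup>2 * \<sigma>\<^sup>2 * (2 + pi)\<^sup>2) \<le> pi\<^sup>2 * t\<^sup>2 / (32 * A\<^sup>2 * (s + pi)\<^sup>2)"
      using \<open>0 < A\<close> \<sigma> by (subst frac_le_eq) (auto simp: divide_le_0_iff algebra_simps)
    also have "\<dots> = t\<^sup>2 / (128 * (A / (2 * pi))\<^sup>2 * (s + pi)\<^sup>2)"
      by (simp add: power_divide power_mult_distrib)
    finally show ?thesis
      unfolding b_const_def by simp
  qed
  finally show "cmod (char M t) \<le> b_const A \<sigma>" .
qed

subsection \<open>Gaussian integrals\<close>

lemma Gamma_half_odd: "Gamma (real j + 1 / 2) = fact (2 * j) / (4 ^ j * fact j) * sqrt pi"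
proof (induction j)
  case 0
  then show ?case by (simp add: Gamma_one_half_real)
next
  case (Suc j)
  have "Gamma (real (Suc j) + 1 / 2) = Gamma ((real j + 1 / 2) + 1)"
    by (simp add: add_ac)
  also have "\<dots> = (real j + 1 / 2) * Gamma (real j + 1 / 2)"
    by (rule Gamma_plus1) (auto simp: nonpos_Ints_def)
  also have "\<dots> = (real j + 1 / 2) * (fact (2 * j) / (4 ^ j * fact j) * sqrt pi)"
    by (simp only: Suc.IH)
  also have "\<dots> = fact (2 * Suc j) / (4 ^ Suc j * fact (Suc j)) * sqrt pi"
  proof -
    have "fact (2 * Suc j) = (2 * real j + 2) * (2 * real j + 1) * fact (2 * j)"
      by (simp add: algebra_simps)
    then show ?thesis
      by (simp add: divide_simps) (simp add: algebra_simps)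
  qed
  finally show ?case .
qed

text \<open>Even and odd moments come as different factorial expressions; the Gamma function covers
  both, at a half-integer for even \<open>k\<close> and at an integer for odd
  \<open>k\<close>.\<close>

lemma std_normal_abs_moment:
  "has_bochner_integral lborel (\<lambda>x. std_normal_density x * \<bar>x\<bar> ^ k)
    (2 powr (real k / 2) * Gamma ((real k + 1) / 2) / sqrt pi)"
proof (cases "even k")
  case True
  then obtain j where k: "k = 2 * j" by (elim evenE)
  have "(real k + 1) / 2 = real j + 1 / 2" "2 powr (real k / 2) = 2 ^ j"
    by (simp_all add: k powr_realpow field_simps)
  moreover have "(4 :: real) ^ j = 2 ^ j * 2 ^ j"
    by (simp flip: power_mult_distrib)
  ultimately have "2 powr (real k / 2) * Gamma ((real k + 1) / 2) / sqrt pi = fact (2 * j) / (2 ^ j * fact j)"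
    by (simp only: Gamma_half_odd) (simp add: divide_simps)
  then show ?thesis
    using std_normal_moment_even[of j] by (simp add: k power_even_abs)
next
  case False
  then obtain j where k: "k = 2 * j + 1" by (elim oddE)
  have G: "Gamma ((real k + 1) / 2) = fact j"
    using Gamma_fact[of j, where ?'a = real] by (simp add: k add_divide_distrib)
  have "2 powr (real k / 2) = 2 powr (real j + 1 / 2)"
    by (simp add: k add_divide_distrib add.commute)
  also have "\<dots> = 2 ^ j * sqrt 2"
    by (simp add: powr_add powr_realpow powr_half_sqrt)
  finally have "2 powr (real k / 2) * Gamma ((real k + 1) / 2) / sqrt pi = sqrt (2 / pi) * 2 ^ j * fact j"
    by (simp add: G real_sqrt_divide)
  then show ?thesis
    using std_normal_moment_abs_odd[of j] by (simp add: k)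
qed

lemma gaussian_abs_moment_8:
  "has_bochner_integral lborel (\<lambda>t. \<bar>t\<bar> ^ k * exp (- (t\<^sup>2) / 8))
    (8 powr ((real k + 1) / 2) * Gamma ((real k + 1) / 2))"
proof -
  let ?G = "Gamma ((real k + 1) / 2)"
  have "has_bochner_integral lborel (\<lambda>y. 2 ^ k * sqrt (2 * pi) * (std_normal_density y * \<bar>y\<bar> ^ k))
      (2 ^ k * sqrt (2 * pi) * (2 powr (real k / 2) * ?G / sqrt pi))"
    by (intro has_bochner_integral_mult_right std_normal_abs_moment)
  also have "(\<lambda>y. 2 ^ k * sqrt (2 * pi) * (std_normal_density y * \<bar>y\<bar> ^ k))
      = (\<lambda>y. \<bar>0 + 2 * y\<bar> ^ k * exp (- ((0 + 2 * y)\<^sup>2) / 8))"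
    by (simp add: std_normal_density_def abs_mult power_mult_distrib fun_eq_iff)
  also have "2 ^ k * sqrt (2 * pi) * (2 powr (real k / 2) * ?G / sqrt pi) = (8 powr ((real k + 1) / 2) * ?G) /\<^sub>R \<bar>2\<bar>"
  proof -
    have "8 powr ((real k + 1) / 2) = (2 powr 3) powr ((real k + 1) / 2)"
      by (simp add: powr_realpow[symmetric] flip: powr_numeral)
    also have "\<dots> = 2 powr (real k + 1 + 1 / 2 + real k / 2)"
      unfolding powr_powr by (rule arg_cong[where f="(powr) 2"]) (simp add: field_simps)
    also have "\<dots> = 2 ^ k * 2 * sqrt 2 * 2 powr (real k / 2)"
      unfolding powr_add by (simp add: powr_realpow powr_half_sqrt)
    finally show ?thesis
      by (simp add: real_sqrt_mult)
  qed
  finally show ?thesis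
    by (subst lborel_has_bochner_integral_real_affine_iff[where c=2 and t=0]) simp_all
qed

text \<open>Used with \<open>k = m + 1\<close> and \<open>k = m\<close>. The factor n from the
  difference of powers and n^(-k/2) from the rescaling combine to the rate n^(-(k-2)/2).\<close>

lemma gaussian_term_integral:
  assumes n: "n \<ge> 1" and k: "k \<ge> 3"
  shows "integrable lborel (\<lambda>t. real n * (\<bar>t / sqrt (real n)\<bar> ^ k / fact k) * exp (- (t\<^sup>2) / 8))"
    and "(LBINT t. real n * (\<bar>t / sqrt (real n)\<bar> ^ k / fact k) * exp (- (t\<^sup>2) / 8)) / (2 * pi)
      \<le> 12 powr ((real k + 1) / 2) * Gamma ((real k + 1) / 2) / (4 * pi * fact k) / real n powr ((real k - 2) / 2)"
proof -
  let ?G = "Gamma ((real k + 1) / 2)" and ?y = "(real k + 1) / 2"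
  have n0: "0 < real n" using n by simp
  have G: "0 < ?G"
    by (rule Gamma_real_pos) simp
  have sq: "sqrt (real n) ^ k = real n powr (real k / 2)"
    using n0 by (simp add: powr_half_sqrt[symmetric] powr_powr flip: powr_realpow)
  have pw: "real n powr (real k / 2) = real n * real n powr ((real k - 2) / 2)"
    using n0 by (subst powr_mult_base) (auto simp: field_simps)
  have "has_bochner_integral lborel (\<lambda>t. real n / (sqrt (real n) ^ k * fact k) * (\<bar>t\<bar> ^ k * exp (- (t\<^sup>2) / 8)))
    (real n / (sqrt (real n) ^ k * fact k) * (8 powr ?y * ?G))"
    by (intro has_bochner_integral_mult_right gaussian_abs_moment_8)
  also have "(\<lambda>t. real n / (sqrt (real n) ^ k * fact k) * (\<bar>t\<bar> ^ k * exp (- (t\<^sup>2) / 8)))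
    = (\<lambda>t. real n * (\<bar>t / sqrt (real n)\<bar> ^ k / fact k) * exp (- (t\<^sup>2) / 8))"
    by (simp add: fun_eq_iff abs_divide power_divide)
  also have "real n / (sqrt (real n) ^ k * fact k) * (8 powr ?y * ?G)
     = 8 powr ?y * ?G / (fact k * real n powr ((real k - 2) / 2))"
    using n0 by (simp add: sq pw)
  finally have *: "has_bochner_integral lborel (\<lambda>t. real n * (\<bar>t / sqrt (real n)\<bar> ^ k / fact k) * exp (- (t\<^sup>2) / 8))
      (8 powr ?y * ?G / (fact k * real n powr ((real k - 2) / 2)))" .
  then show "integrable lborel (\<lambda>t. real n * (\<bar>t / sqrt (real n)\<bar> ^ k / fact k) * exp (- (t\<^sup>2) / 8))"
    by (rule integrable.intros)
  \<comment> \<open>As \<open>k \<ge> 3\<close>, the exponent is at least 2, and (3/2)^2 > 2: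
    replacing base 8 by 12 gains the factor 2 that turns 1 / (2 pi) into 1 / (4 pi).\<close>
  have "(3 / 2 :: real) powr 2 \<le> (3 / 2) powr ?y"
    using k by (intro powr_mono) auto
  then have "2 \<le> (3 / 2 :: real) powr ?y"
    by (simp add: power_divide)
  then have "2 * 8 powr ?y \<le> (3 / 2) powr ?y * 8 powr ?y"
    by (rule mult_right_mono) simp
  also have "\<dots> = 12 powr ?y"
    by (simp flip: powr_mult)
  finally have "2 * 8 powr ?y * ?G / (4 * pi * fact k * real n powr ((real k - 2) / 2))
      \<le> 12 powr ?y * ?G / (4 * pi * fact k * real n powr ((real k - 2) / 2))"
    using G by (intro divide_right_mono mult_right_mono) auto
  then show "(LBINT t. real n * (\<bar>t / sqrt (real n)\<bar> ^ k / fact k) * exp (- (t\<^sup>2) / 8)) / (2 * pi)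
      \<le> 12 powr ?y * ?G / (4 * pi * fact k) / real n powr ((real k - 2) / 2)"
    unfolding has_bochner_integral_integral_eq[OF *] by (simp add: mult_ac)
qed

text \<open>On the tail 1 \<le> |t| / a, and with this extra factor the Gaussian has an elementary
  antiderivative.\<close>

lemma gaussian_tail:
  fixes a :: real
  assumes a: "a > 0"
  shows "integrable lborel (\<lambda>t. indicator {t. a < \<bar>t\<bar>} t * exp (- (t\<^sup>2) / 2))"
    and "(LBINT t. indicator {t. a < \<bar>t\<bar>} t * exp (- (t\<^sup>2) / 2)) \<le> 2 * exp (- (a\<^sup>2) / 2) / a"
proof -
  define f where "f t = indicator {t. a \<le> \<bar>t\<bar>} t * (\<bar>t\<bar> / a * exp (- (t\<^sup>2) / 2))" for t :: real
  have [measurable]: "f \<in> borel_measurable borel"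
    unfolding f_def by measurable
  have "has_bochner_integral lborel (\<lambda>t. indicator {0..} t *\<^sub>R f t) (exp (- (a\<^sup>2) / 2) / a)"
  proof (rule has_bochner_integral_nn_integral)
    have "(\<integral>\<^sup>+t. ennreal (indicator {0..} t *\<^sub>R f t) \<partial>lborel)
        = (\<integral>\<^sup>+t. ennreal (t / a * exp (- (t\<^sup>2) / 2)) * indicator {a..} t \<partial>lborel)"
      using a by (intro nn_integral_cong) (auto simp: f_def indicator_def)
    also have "\<dots> = ennreal (0 - - (exp (- (a\<^sup>2) / 2) / a))"
    proof (rule nn_integral_FTC_atLeast[where F="\<lambda>t. - (exp (- (t\<^sup>2) / 2) / a)"])
      show "((\<lambda>t. - (exp (- (t\<^sup>2) / 2) / a)) has_real_derivative t / a * exp (- (t\<^sup>2) / 2)) (at t)" for t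
        using a by (auto intro!: derivative_eq_intros)
      have "filterlim (\<lambda>t :: real. - (1 / 2 * t\<^sup>2)) at_bot at_top"
        by (intro filterlim_compose[OF filterlim_uminus_at_bot_at_top] filterlim_tendsto_pos_mult_at_top[OF tendsto_const]
            filterlim_pow_at_top filterlim_ident) auto
      then have "((\<lambda>t. - (exp (- (1 / 2 * t\<^sup>2)) / a)) \<longlongrightarrow> - (0 / a)) at_top"
        by (intro tendsto_intros filterlim_compose[OF exp_at_bot]) (use a in auto)
      then show "((\<lambda>t. - (exp (- (t\<^sup>2) / 2) / a)) \<longlongrightarrow> 0) at_top" by simp
    qed (use a in auto)
    finally show "(\<integral>\<^sup>+t. ennreal (indicator {0..} t *\<^sub>R f t) \<partial>lborel) = ennreal (exp (- (a\<^sup>2) / 2) / a)"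
      by simp
  qed (use a in \<open>auto simp: f_def\<close>)
  then have f: "has_bochner_integral lborel f (2 *\<^sub>R (exp (- (a\<^sup>2) / 2) / a))"
    by (rule has_bochner_integral_even_function) (auto simp: f_def indicator_def)
  have le: "indicator {t. a < \<bar>t\<bar>} t * exp (- (t\<^sup>2) / 2) \<le> f t" for t
  proof (cases "a < \<bar>t\<bar>")
    case True
    then have "1 * exp (- (t\<^sup>2) / 2) \<le> \<bar>t\<bar> / a * exp (- (t\<^sup>2) / 2)"
      using a by (intro mult_right_mono) auto
    then show ?thesis
      using True by (simp add: f_def indicator_def)
  qed (use a in \<open>auto simp: f_def indicator_def\<close>)
  show int: "integrable lborel (\<lambda>t. indicator {t. a < \<bar>t\<bar>} t * exp (- (t\<^sup>2) / 2))"
    by (rule Bochner_Integration.integrable_bound[OF integrable.intros[OF f]])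
      (use order_trans[OF le abs_ge_self] in auto)
  show "(LBINT t. indicator {t. a < \<bar>t\<bar>} t * exp (- (t\<^sup>2) / 2)) \<le> 2 * exp (- (a\<^sup>2) / 2) / a"
    using integral_mono[OF int integrable.intros[OF f] le]
    by (simp add: has_bochner_integral_integral_eq[OF f])
qed

subsection \<open>Elementary inequalities\<close>

text \<open>From index \<open>j\<close> on, each step from k to k + 1 multiplies by s / (k + 1),
  which is at most 1.\<close>

lemma power_div_fact_antimono:
  fixes s :: real
  assumes "0 \<le> s" "s \<le> real j + 1" "j \<le> m"
  shows "s ^ m / fact m \<le> s ^ j / fact j"
  using \<open>j \<le> m\<close>
proof (induction m rule: dec_induct)
  case base
  then show ?case by simp
next
  case (step k)
  have "s ^ Suc k / fact (Suc k) = s / real (Suc k) * (s ^ k / fact k)"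
    by simp
  also have "\<dots> \<le> 1 * (s ^ k / fact k)"
    using assms step by (intro mult_right_mono) (auto simp: divide_le_eq)
  finally show ?case
    using step by simp
qed

lemma exp_ge_two_terms:
  fixes s :: real
  assumes "0 \<le> s" "1 \<le> m"
  shows "1 + s ^ m / fact m + s ^ Suc m / fact (Suc m) \<le> exp s"
proof -
  have "(\<Sum>k\<in>{0, m, Suc m}. s ^ k /\<^sub>R fact k) \<le> exp s"
    unfolding exp_def by (rule sum_le_suminf) (use assms summable_exp_generic[of s] in auto)
  then show ?thesis
    using assms by (simp add: divide_inverse mult_ac del: fact_Suc power_Suc)
qed

text \<open>The value 4 separates two regimes. Up to it s^k / k! does not increase from k = 3 on, so
  m = 3 is the worst case and a quadratic Taylor bound suffices; beyond it s \<le> s^2 / 4, and the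
  two terms are part of the series of exp s.\<close>

lemma remainder_le_exp:
  fixes s :: real
  assumes s: "0 \<le> s" and m: "3 \<le> m"
  shows "7 / 20 * (s ^ Suc m / fact (Suc m) + 2 * s ^ m / fact m) \<le> exp (s\<^sup>2 / 4) - 1"
proof (cases "s \<le> 4")
  case True
  have "s ^ m / fact m \<le> s ^ 3 / fact 3" "s ^ Suc m / fact (Suc m) \<le> s ^ 4 / fact 4"
    using power_div_fact_antimono[of s 3 m] power_div_fact_antimono[of s 4 "Suc m"] s m True
    by (simp_all del: fact_Suc power_Suc)
  then have "7 / 20 * (s ^ Suc m / fact (Suc m) + 2 * s ^ m / fact m) \<le> 7 / 20 * (s ^ 4 / 24 + s ^ 3 / 3)"
    by (simp add: fact_numeral del: fact_Suc power_Suc)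
  also have "\<dots> \<le> s\<^sup>2 / 4 + (s\<^sup>2 / 4)\<^sup>2 / 2"
  proof -
    \<comment> \<open>The difference of the two sides is s^2 (s^2 - 7 s + 15) / 60; the square is
      completed.\<close>
    have "0 \<le> s\<^sup>2 / 60 * ((s - 7 / 2)\<^sup>2 + 11 / 4)"
      by (intro mult_nonneg_nonneg add_nonneg_nonneg) auto
    then show ?thesis
      by (simp add: power2_eq_square power3_eq_cube power4_eq_xxxx algebra_simps)
  qed
  also have "\<dots> \<le> exp (s\<^sup>2 / 4) - 1"
    using exp_lower_Taylor_quadratic[of "s\<^sup>2 / 4"] by simp
  finally show ?thesis .
next
  case False
  have *: "7 / 20 * (u + 2 * v) \<le> u + v" if "0 \<le> u" "0 \<le> v" for u v :: real
    using that by simp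
  have "0 \<le> s ^ Suc m / fact (Suc m)" "0 \<le> s ^ m / fact m"
    using s by (simp_all del: fact_Suc power_Suc)
  from *[OF this] have "7 / 20 * (s ^ Suc m / fact (Suc m) + 2 * s ^ m / fact m) \<le> s ^ Suc m / fact (Suc m) + s ^ m / fact m"
    by (simp only: times_divide_eq_right)
  also have "\<dots> \<le> exp s - 1"
    using exp_ge_two_terms[of s m] s m by simp
  also have "exp s \<le> exp (s\<^sup>2 / 4)"
    using False by (simp add: power2_eq_square)
  finally show ?thesis by simp
qed

text \<open>
  The factor \<open>7/20\<close> is any number with square at least \<open>exp (- 3/2) / 2\<close> that still satisfies the
  previous lemma; \<open>\<nu>\<close> is bounded by the geometric mean of its two bounds.
\<close>

lemma nu_le_exp:
  fixes s \<nu> :: real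
  assumes "0 \<le> \<nu>" "\<nu> < 1 / 2 * exp (- 3 / 2)" "\<nu> \<le> exp (- (s\<^sup>2))"
  shows "\<nu> \<le> 7 / 20 * exp (- (s\<^sup>2) / 2)"
proof (rule power2_le_imp_le)
  \<comment> \<open>Needed is exp(3/2) \<ge> 200/49, about 4.08; cubing the quadratic Taylor bound
    13/8 for exp(1/2) gives about 4.29.\<close>
  have "13 / 8 \<le> exp (1 / 2 :: real)"
    using exp_lower_Taylor_quadratic[of "1 / 2"] by (simp add: power2_eq_square)
  then have "(13 / 8) ^ 3 \<le> exp (1 / 2 :: real) ^ 3"
    by (rule power_mono) simp
  also have "\<dots> = exp (3 / 2 :: real)"
    by (simp flip: exp_of_nat_mult)
  finally have "1 / 2 * exp (- 3 / 2 :: real) \<le> (7 / 20)\<^sup>2"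
    by (simp add: exp_minus field_simps power2_eq_square power3_eq_cube)
  then have "\<nu> * \<nu> \<le> (7 / 20)\<^sup>2 * exp (- (s\<^sup>2))"
    using assms by (intro mult_mono) auto
  also have "\<dots> = (7 / 20 * exp (- (s\<^sup>2) / 2))\<^sup>2"
  proof -
    have "exp (- (s\<^sup>2)) = (exp (- (s\<^sup>2) / 2))\<^sup>2"
      unfolding exp_double[symmetric] by simp
    then show ?thesis
      by (simp only: power_mult_distrib)
  qed
  finally show "\<nu>\<^sup>2 \<le> (7 / 20 * exp (- (s\<^sup>2) / 2))\<^sup>2"
    by (simp add: power2_eq_square)
qed simp

text \<open>After division by \<open>r\<close> both numbers lie in the unit disc, where n times
  their difference bounds the difference of powers.\<close>

lemma norm_power_diff_le:
  fixes z w :: complex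
  assumes "0 < r" "cmod z \<le> r" "cmod w \<le> r" "1 \<le> n"
  shows "cmod (z ^ n - w ^ n) \<le> real n * cmod (z - w) * r ^ (n - 1)"
proof -
  have "cmod ((z / r) ^ n - (w / r) ^ n) \<le> real n * cmod (z / r - w / r)"
    by (rule norm_power_diff) (use assms in \<open>auto simp: norm_divide\<close>)
  also have "z / r - w / r = (z - w) / r"
    by (simp add: diff_divide_distrib)
  also have "(z / r) ^ n - (w / r) ^ n = (z ^ n - w ^ n) / r ^ n"
    by (simp add: power_divide diff_divide_distrib)
  finally have "cmod (z ^ n - w ^ n) / r ^ n \<le> real n * cmod (z - w) / r"
    using assms by (simp add: norm_divide norm_power)
  moreover have "r ^ n = r * r ^ (n - 1)"
    using assms by (simp flip: power_Suc)
  ultimately show ?thesis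
    using assms by (simp add: field_simps)
qed

text \<open>The number \<open>a\<close> is the |t| at which exp(-t^2/n) equals \<nu>; there
  exp(-t^2/2) is \<nu>^(n/2).\<close>

lemma tail_constant_le:
  fixes \<nu> :: real
  assumes "0 < \<nu>" "\<nu> < 1 / 2 * exp (- 3 / 2)" and n: "2 \<le> n"
  defines "a \<equiv> sqrt (real n) * sqrt (- ln \<nu>)"
  shows "0 < a" and "a\<^sup>2 = - real n * ln \<nu>"
    and "2 * exp (- (a\<^sup>2) / 2) / a / (2 * pi) \<le> \<nu> * (exp (3 / 2) / pi) * (exp (- real n / 2) / real n)"
proof -
  define l where "l = - ln \<nu>"
  have \<nu>: "\<nu> = exp (- l)"
    using assms by (simp add: l_def)
  \<comment> \<open>This turns the bound on \<nu> into \<nu> < exp(-2), that is l > 2.\<close>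
  have "exp (1 / 2 :: real) \<le> 2"
  proof (rule power2_le_imp_le)
    show "(exp (1 / 2))\<^sup>2 \<le> (2 :: real)\<^sup>2"
      using exp_le by (simp flip: exp_double)
  qed simp
  then have "1 / 2 * exp (- 3 / 2) \<le> exp (- 2 :: real)"
    using mult_right_mono[of "exp (1 / 2)" "2 :: real" "exp (-2)"] by (simp flip: exp_add)
  then have "exp (- l) < exp (- 2)"
    using assms \<nu> by linarith
  then have l: "2 < l" by simp
  have n0: "0 < real n" using n by simp
  show "0 < a"
    unfolding a_def l_def[symmetric] using l n0 by simp
  show a2: "a\<^sup>2 = - real n * ln \<nu>"
    unfolding a_def using l n0 by (simp add: power_mult_distrib l_def)
  have "real n \<le> exp (real n - 1)"
    using exp_ge_add_one_self[of "real n - 1"] by simp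
  then have "sqrt (real n) \<le> sqrt (exp (real n - 1))"
    by simp
  also have "\<dots> = exp ((real n - 1) / 2)"
    by (rule real_sqrt_unique) (simp_all flip: exp_double)
  also have "\<dots> \<le> exp (3 / 2 - l - real n / 2 + real n * l / 2)"
  proof -
    \<comment> \<open>The two exponents differ by exactly (n - 2) (l - 2) / 2.\<close>
    have "0 \<le> (real n - 2) * (l - 2)"
      using l n by (intro mult_nonneg_nonneg) auto
    then show ?thesis
      by (simp add: field_simps)
  qed
  also have "\<dots> \<le> sqrt l * exp (3 / 2 - l - real n / 2 + real n * l / 2)"
    using l by (simp add: mult_le_cancel_right1)
  finally have "sqrt (real n) \<le> sqrt l * exp (3 / 2 - l - real n / 2 + real n * l / 2)" .
  then have "sqrt (real n) * exp (- (real n * l / 2)) \<le> sqrt l * exp (3 / 2 - l - real n / 2 + real n * l / 2) * exp (- (real n * l / 2))"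
    by (rule mult_right_mono) simp
  also have "\<dots> = sqrt l * exp (3 / 2 - l - real n / 2)"
    by (simp add: mult.assoc flip: exp_add)
  also have "\<dots> = sqrt l * (\<nu> * exp (3 / 2) * exp (- real n / 2))"
    unfolding \<nu> by (simp flip: exp_add)
  finally have *: "sqrt (real n) * exp (- (real n * l / 2)) \<le> sqrt l * (\<nu> * exp (3 / 2) * exp (- real n / 2))" .
  have "exp (- (real n * l / 2)) / (sqrt (real n) * sqrt l) = sqrt (real n) * exp (- (real n * l / 2)) / (real n * sqrt l)"
    using n0 l by (simp add: field_simps)
  also have "\<dots> \<le> sqrt l * (\<nu> * exp (3 / 2) * exp (- real n / 2)) / (real n * sqrt l)"
    using l n0 by (intro divide_right_mono *) auto
  also have "\<dots> = \<nu> * exp (3 / 2) * exp (- real n / 2) / real n"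
    using l by simp
  finally have "exp (- (real n * l / 2)) / (sqrt (real n) * sqrt l) / pi \<le> \<nu> * exp (3 / 2) * exp (- real n / 2) / real n / pi"
    by (rule divide_right_mono) simp
  then show "2 * exp (- (a\<^sup>2) / 2) / a / (2 * pi) \<le> \<nu> * (exp (3 / 2) / pi) * (exp (- real n / 2) / real n)"
    unfolding a2 unfolding a_def l_def by (simp add: mult_ac)
qed

subsection \<open>The local limit estimate\<close>

lemma nu1_nonneg: "0 \<le> nu1 L \<sigma> n m" and nu2_nonneg: "0 \<le> nu2 L \<sigma> n m"
  unfolding nu1_def nu2_def set_lebesgue_integral_def by (auto intro!: integral_nonneg_AE)

context real_distribution
begin

text \<open>All four terms are nonnegative, so for each \<open>t\<close> two of them suffice: the
  first pair where \<nu> \<le> exp(-s^2), the second pair elsewhere. Only the last needs an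
  indicator; the others have the required size when integrated over the whole line.\<close>

lemma cmod_char_power_diff_le:
  fixes m n :: nat and \<sigma> t :: real
  assumes int: "integrable lborel (\<lambda>t. cmod (char M t))"
    and \<sigma>: "\<sigma> > 0" and m: "m \<ge> 3" and n: "n \<ge> 2"
    and sq: "integrable M (\<lambda>x. x\<^sup>2)" and mean: "(LINT x|M. x) = 0" and var: "(LINT x|M. x\<^sup>2) = \<sigma>\<^sup>2"
    and exists: "pseudomoment_exists M \<sigma> m"
    and zero: "\<And>k. k \<in> {3..m} \<Longrightarrow> pseudomoment M \<sigma> k = 0"
    and nu: "nu M \<sigma> n m < 1 / 2 * exp (- 3 / 2)"
  defines "A \<equiv> (LBINT t. cmod (char M t))"
  shows "cmod (char M (t / (\<sigma> * sqrt (real n))) ^ n - exp (- (t\<^sup>2) / 2))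
    \<le> nu1 M \<sigma> n m * (real n * (\<bar>t / sqrt (real n)\<bar> ^ (m + 1) / fact (m + 1)) * exp (- (t\<^sup>2) / 8))
      + 2 * nu2 M \<sigma> n m * (real n * (\<bar>t / sqrt (real n)\<bar> ^ m / fact m) * exp (- (t\<^sup>2) / 8))
      + b_const A \<sigma> ^ (n - 1) * cmod (char M (t / (\<sigma> * sqrt (real n))))
      + indicator {t. exp (- ((t / sqrt (real n))\<^sup>2)) < nu M \<sigma> n m} t * exp (- (t\<^sup>2) / 2)"
    (is "?lhs \<le> ?T1 + ?T2 + ?T3 + ?T4")
proof -
  define s where "s = t / sqrt (real n)"
  define g where "g = char M (s / \<sigma>)"
  define \<nu>\<^sub>1 \<nu>\<^sub>2 \<nu> where "\<nu>\<^sub>1 = nu1 M \<sigma> n m" and "\<nu>\<^sub>2 = nu2 M \<sigma> n m" and "\<nu> = nu M \<sigma> n m"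
  have \<nu>: "0 \<le> \<nu>\<^sub>1" "0 \<le> \<nu>\<^sub>2" "\<nu>\<^sub>1 \<le> \<nu>" "\<nu>\<^sub>2 \<le> \<nu>" "0 \<le> \<nu>"
    using nu1_nonneg[of M \<sigma> n m] nu2_nonneg[of M \<sigma> n m] by (auto simp: \<nu>\<^sub>1_def \<nu>\<^sub>2_def \<nu>_def nu_def)
  have n0: "0 < real n" using n by simp
  have t2: "t\<^sup>2 = real n * s\<^sup>2"
    using n0 by (simp add: s_def power_divide)
  have g: "char M (t / (\<sigma> * sqrt (real n))) = g"
    by (simp add: g_def s_def mult.commute)
  have w: "complex_of_real (exp (- (t\<^sup>2) / 2)) = complex_of_real (exp (- (s\<^sup>2) / 2)) ^ n"
    by (simp add: t2 flip: exp_of_nat_mult of_real_power)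
  have "0 \<le> ?T1"
    using \<nu> by (auto simp: \<nu>\<^sub>1_def)
  have "0 \<le> ?T2"
    using \<nu> by (auto simp: \<nu>\<^sub>2_def)
  have "0 \<le> ?T3"
    by (simp add: b_const_def)
  define P where "P = \<bar>s\<bar> ^ Suc m / fact (Suc m) + 2 * \<bar>s\<bar> ^ m / fact m"
  have h: "cmod (g - exp (- (s\<^sup>2) / 2)) \<le> \<bar>s\<bar> ^ (m + 1) / fact (m + 1) * \<nu>\<^sub>1 + 2 * \<bar>s\<bar> ^ m / fact m * \<nu>\<^sub>2"
    unfolding g_def \<nu>\<^sub>1_def \<nu>\<^sub>2_def by (rule cmod_char_diff_le[OF \<sigma> m sq mean var exists zero])
  show ?thesis
  proof (cases "\<nu> \<le> exp (- (s\<^sup>2))")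
    case True
    define r where "r = exp (- (s\<^sup>2) / 4)"
    have "\<nu> \<le> 7 / 20 * exp (- (s\<^sup>2) / 2)"
      by (rule nu_le_exp) (use \<nu> nu True in \<open>auto simp: \<nu>_def\<close>)
    \<comment> \<open>Merging both truncated pseudomoments into \<nu> is affordable only for the
      size of \<open>g\<close>; the final difference goes back to \<open>h\<close>, which keeps them
      apart.\<close>
    note h
    also have "\<bar>s\<bar> ^ (m + 1) / fact (m + 1) * \<nu>\<^sub>1 + 2 * \<bar>s\<bar> ^ m / fact m * \<nu>\<^sub>2
        \<le> \<bar>s\<bar> ^ (m + 1) / fact (m + 1) * \<nu> + 2 * \<bar>s\<bar> ^ m / fact m * \<nu>"
      using \<nu> by (intro add_mono mult_left_mono) auto
    also have "\<dots> = P * \<nu>"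
      by (simp add: P_def distrib_right)
    also have "\<dots> \<le> P * (7 / 20 * exp (- (s\<^sup>2) / 2))"
      by (rule mult_left_mono) (fact, simp add: P_def)
    finally have "cmod (g - exp (- (s\<^sup>2) / 2)) \<le> 7 / 20 * P * exp (- (s\<^sup>2) / 2)"
      by simp
    also have "\<dots> \<le> (exp (s\<^sup>2 / 4) - 1) * exp (- (s\<^sup>2) / 2)"
      using remainder_le_exp[of "\<bar>s\<bar>" m] m unfolding P_def by (intro mult_right_mono) auto
    also have "\<dots> = r - exp (- (s\<^sup>2) / 2)"
      by (simp add: left_diff_distrib r_def flip: exp_add)
    finally have gr: "cmod (g - exp (- (s\<^sup>2) / 2)) \<le> r - exp (- (s\<^sup>2) / 2)" .
    have "cmod g \<le> cmod (g - exp (- (s\<^sup>2) / 2)) + cmod (exp (- (s\<^sup>2) / 2))"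
      using norm_triangle_ineq[of "g - exp (- (s\<^sup>2) / 2)" "exp (- (s\<^sup>2) / 2)"] by simp
    also have "cmod (exp (- (s\<^sup>2) / 2)) = exp (- (s\<^sup>2) / 2)"
      by (simp only: norm_of_real abs_exp_cancel)
    finally have "cmod g \<le> r"
      using gr by simp
    moreover have "cmod (exp (- (s\<^sup>2) / 2)) \<le> r"
      unfolding norm_of_real by (simp add: r_def)
    ultimately have "?lhs \<le> real n * cmod (g - exp (- (s\<^sup>2) / 2)) * r ^ (n - 1)"
      unfolding g w using n by (intro norm_power_diff_le) (auto simp: r_def)
    also have "\<dots> \<le> real n * (\<bar>s\<bar> ^ (m + 1) / fact (m + 1) * \<nu>\<^sub>1 + 2 * \<bar>s\<bar> ^ m / fact m * \<nu>\<^sub>2) * exp (- (t\<^sup>2) / 8)"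
    proof (intro mult_mono mult_left_mono h)
      \<comment> \<open>The exponent (n - 1) / (4 n) is at least 1/8 exactly when n \<ge> 2.\<close>
      have "r ^ (n - 1) = exp (real (n - 1) * (- (s\<^sup>2) / 4))"
        by (simp only: r_def exp_of_nat_mult)
      also have "\<dots> \<le> exp (- (t\<^sup>2) / 8)"
      proof -
        have "0 \<le> (real n - 2) * s\<^sup>2"
          using n by simp
        then show ?thesis
          using n by (simp add: t2 of_nat_diff field_simps)
      qed
      finally show "r ^ (n - 1) \<le> exp (- (t\<^sup>2) / 8)" .
    qed (use \<nu> in \<open>auto simp: r_def\<close>)
    also have "\<dots> = ?T1 + ?T2"
      unfolding s_def[symmetric] \<nu>\<^sub>1_def[symmetric] \<nu>\<^sub>2_def[symmetric] by (simp add: algebra_simps)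
    finally show ?thesis
      using \<open>0 \<le> ?T3\<close> by (simp add: add_increasing2)
  next
    case False
    then have "exp (- (s\<^sup>2)) < 1 / 2 * exp (- 3 / 2)"
      using nu by (simp add: \<nu>_def)
    also have "\<dots> \<le> exp (- 1)"
    proof -
      have "exp (- 3 / 2) \<le> exp (- 1 :: real)" by simp
      moreover have "0 < exp (- 3 / 2 :: real)" by simp
      ultimately show ?thesis by linarith
    qed
    finally have "1 \<le> s\<^sup>2" by simp
    then have "1 \<le> \<bar>s\<bar>"
      using abs_le_square_iff[of 1 s] by simp
    then have "cmod g \<le> b_const A \<sigma>"
      unfolding g_def A_def using \<sigma> by (intro cmod_char_le_b_const[OF int \<sigma> sq mean var]) (simp add: abs_divide)
    have "?lhs \<le> cmod (g ^ n) + cmod (exp (- (t\<^sup>2) / 2))"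
      unfolding g by (rule norm_triangle_ineq4)
    \<comment> \<open>One factor \<open>cmod g\<close> is kept: it makes the bound integrable in
      \<open>t\<close>, and its integral produces \<open>A\<close>.\<close>
    also have "cmod (g ^ n) = cmod g ^ (n - 1) * cmod g"
      using n by (simp add: norm_power flip: power_Suc2)
    also have "\<dots> \<le> b_const A \<sigma> ^ (n - 1) * cmod g"
      by (intro mult_right_mono power_mono) (fact, auto)
    also have "\<dots> + cmod (exp (- (t\<^sup>2) / 2)) = ?T3 + ?T4"
      unfolding g norm_of_real abs_exp_cancel using False by (simp add: s_def \<nu>_def)
    finally show ?thesis
      using \<open>0 \<le> ?T1\<close> \<open>0 \<le> ?T2\<close> by simp
  qed
qed

lemma integral_cmod_char_power_diff_le:
  fixes m n :: nat and \<sigma> :: real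
  assumes int: "integrable lborel (\<lambda>t. cmod (char M t))"
    and \<sigma>: "\<sigma> > 0" and m: "m \<ge> 3" and n: "n \<ge> 2"
    and sq: "integrable M (\<lambda>x. x\<^sup>2)" and mean: "(LINT x|M. x) = 0" and var: "(LINT x|M. x\<^sup>2) = \<sigma>\<^sup>2"
    and exists: "pseudomoment_exists M \<sigma> m"
    and zero: "\<And>k. k \<in> {3..m} \<Longrightarrow> pseudomoment M \<sigma> k = 0"
    and nu: "nu M \<sigma> n m < 1 / 2 * exp (- 3 / 2)"
  defines "A \<equiv> (LBINT t. cmod (char M t))"
  shows "(LBINT t. cmod (char M (t / (\<sigma> * sqrt (real n))) ^ n - exp (- (t\<^sup>2) / 2))) / (2 * pi)
    \<le> C3 m * nu1 M \<sigma> n m / real n powr ((real m - 1) / 2)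
       + C4 m * nu2 M \<sigma> n m / real n powr ((real m - 2) / 2)
       + b_const A \<sigma> ^ (n - 1) * (\<sigma> * sqrt (real n) / (2 * pi)) * A
       + nu M \<sigma> n m * (exp (3 / 2) / pi) * (exp (- real n / 2) / real n)"
proof -
  define \<nu>\<^sub>1 \<nu>\<^sub>2 \<nu> where "\<nu>\<^sub>1 = nu1 M \<sigma> n m" and "\<nu>\<^sub>2 = nu2 M \<sigma> n m" and "\<nu> = nu M \<sigma> n m"
  have \<nu>: "0 \<le> \<nu>\<^sub>1" "0 \<le> \<nu>\<^sub>2" "0 \<le> \<nu>"
    using nu1_nonneg[of M \<sigma> n m] nu2_nonneg[of M \<sigma> n m] by (auto simp: \<nu>\<^sub>1_def \<nu>\<^sub>2_def \<nu>_def nu_def)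
  have n0: "0 < real n" and n1: "1 \<le> n" using n by simp_all
  define J where "J k t = real n * (\<bar>t / sqrt (real n)\<bar> ^ k / fact k) * exp (- (t\<^sup>2) / 8)" for k t
  define T where "T t = cmod (char M (t / (\<sigma> * sqrt (real n))))" for t
  define E where "E t = indicator {t. exp (- ((t / sqrt (real n))\<^sup>2)) < \<nu>} t * exp (- (t\<^sup>2) / 2)" for t :: real
  have J: "integrable lborel (J k)"
    "(LBINT t. J k t) / (2 * pi) \<le> 12 powr ((real k + 1) / 2) * Gamma ((real k + 1) / 2) / (4 * pi * fact k) / real n powr ((real k - 2) / 2)"
    if "k \<ge> 3" for k
    unfolding J_def using gaussian_term_integral[OF n1 that] by auto
  have c0: "1 / (\<sigma> * sqrt (real n)) \<noteq> 0"
    using \<sigma> n0 by simp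
  have T_int: "integrable lborel T"
    using lborel_integrable_real_affine[OF int c0, of 0] by (simp add: T_def[abs_def])
  have "A = \<bar>1 / (\<sigma> * sqrt (real n))\<bar> *\<^sub>R (LBINT t. T t)"
    unfolding A_def using lborel_integral_real_affine[OF c0, of "\<lambda>t. cmod (char M t)" 0] by (simp add: T_def)
  then have T: "(LBINT t. T t) = \<sigma> * sqrt (real n) * A"
    using \<sigma> n0 by (simp add: field_simps)
  have E: "integrable lborel E" "(LBINT t. E t) / (2 * pi) \<le> \<nu> * (exp (3 / 2) / pi) * (exp (- real n / 2) / real n)"
  proof -
    have "integrable lborel E \<and> (LBINT t. E t) / (2 * pi) \<le> \<nu> * (exp (3 / 2) / pi) * (exp (- real n / 2) / real n)"
    \<comment> \<open>For \<nu> = 0 the indicator is empty, and \<open>ln \<nu>\<close> would be a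
      mere default value that defines no meaningful cut.\<close>
    proof (cases "\<nu> = 0")
      case True
      then have "E = (\<lambda>_. 0)"
        by (auto simp: E_def fun_eq_iff not_less)
      then show ?thesis
        using True by simp
    next
      case False
      define a where "a = sqrt (real n) * sqrt (- ln \<nu>)"
      have "0 < \<nu>" "\<nu> < 1 / 2 * exp (- 3 / 2)"
        using False \<nu> nu by (auto simp: \<nu>_def)
      note a = tail_constant_le[OF this n, folded a_def]
      have "exp (- ((t / sqrt (real n))\<^sup>2)) < \<nu> \<longleftrightarrow> a < \<bar>t\<bar>" for t
      proof -
        have "exp (- ((t / sqrt (real n))\<^sup>2)) < \<nu> \<longleftrightarrow> - ((t / sqrt (real n))\<^sup>2) < ln \<nu>"
          using \<open>0 < \<nu>\<close> by (metis exp_less_cancel_iff exp_ln)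
        also have "\<dots> \<longleftrightarrow> a\<^sup>2 < t\<^sup>2"
          using n0 by (simp add: a(2) power_divide field_simps) linarith
        also have "\<dots> \<longleftrightarrow> a < \<bar>t\<bar>"
          using a(1) abs_le_square_iff[of t a] by (metis abs_of_pos not_le)
        finally show ?thesis .
      qed
      then have "E = (\<lambda>t. indicator {t. a < \<bar>t\<bar>} t * exp (- (t\<^sup>2) / 2))"
        by (simp add: E_def fun_eq_iff)
      then show ?thesis
        using gaussian_tail[OF a(1)] a(3) divide_right_mono[OF gaussian_tail(2)[OF a(1)], of "2 * pi"] by simp
    qed
    then show "integrable lborel E" "(LBINT t. E t) / (2 * pi) \<le> \<nu> * (exp (3 / 2) / pi) * (exp (- real n / 2) / real n)"
      by auto
  qed
  have m3: "3 \<le> m + 1" using m by simp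
  have le: "cmod (char M (t / (\<sigma> * sqrt (real n))) ^ n - exp (- (t\<^sup>2) / 2))
      \<le> \<nu>\<^sub>1 * J (m + 1) t + 2 * \<nu>\<^sub>2 * J m t + b_const A \<sigma> ^ (n - 1) * T t + E t" for t
    unfolding \<nu>\<^sub>1_def \<nu>\<^sub>2_def \<nu>_def J_def T_def E_def A_def
    by (rule cmod_char_power_diff_le[OF int \<sigma> m n sq mean var exists zero nu])
  have "(LBINT t. cmod (char M (t / (\<sigma> * sqrt (real n))) ^ n - exp (- (t\<^sup>2) / 2)))
      \<le> (LBINT t. \<nu>\<^sub>1 * J (m + 1) t + 2 * \<nu>\<^sub>2 * J m t + b_const A \<sigma> ^ (n - 1) * T t + E t)"
    by (rule integral_mono'[OF _ le order_trans[OF norm_ge_zero le]])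
      (use J(1)[OF m] J(1)[OF m3] T_int E(1) in auto)
  also have "\<dots> = \<nu>\<^sub>1 * (LBINT t. J (m + 1) t) + 2 * \<nu>\<^sub>2 * (LBINT t. J m t)
      + b_const A \<sigma> ^ (n - 1) * (\<sigma> * sqrt (real n) * A) + (LBINT t. E t)"
    using J(1)[OF m] J(1)[OF m3] T_int E(1) by (simp add: T)
  finally have "(LBINT t. cmod (char M (t / (\<sigma> * sqrt (real n))) ^ n - exp (- (t\<^sup>2) / 2))) / (2 * pi)
    \<le> (\<nu>\<^sub>1 * (LBINT t. J (m + 1) t) + 2 * \<nu>\<^sub>2 * (LBINT t. J m t)
      + b_const A \<sigma> ^ (n - 1) * (\<sigma> * sqrt (real n) * A) + (LBINT t. E t)) / (2 * pi)"
    by (rule divide_right_mono) simp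
  also have "\<dots> = \<nu>\<^sub>1 * ((LBINT t. J (m + 1) t) / (2 * pi)) + 2 * \<nu>\<^sub>2 * ((LBINT t. J m t) / (2 * pi))
      + b_const A \<sigma> ^ (n - 1) * (\<sigma> * sqrt (real n) / (2 * pi)) * A + (LBINT t. E t) / (2 * pi)"
    by (simp add: add_divide_distrib)
  also have "\<dots> \<le> \<nu>\<^sub>1 * (C3 m / real n powr ((real m - 1) / 2)) + 2 * \<nu>\<^sub>2 * (C4 m / 2 / real n powr ((real m - 2) / 2))
      + b_const A \<sigma> ^ (n - 1) * (\<sigma> * sqrt (real n) / (2 * pi)) * A
      + \<nu> * (exp (3 / 2) / pi) * (exp (- real n / 2) / real n)"
  proof (intro add_mono mult_left_mono order_refl)
    \<comment> \<open>\<open>C3 m\<close> belongs to \<open>k = m + 1\<close> and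
      \<open>C4 m / 2\<close> to \<open>k = m\<close>; the missing factor 2 is that of the Taylor
      remainder of order \<open>m\<close>.\<close>
    have "(real (m + 1) + 1) / 2 = (real m + 2) / 2" "(real m + 2) / 2 = real m / 2 + 1" "(real (m + 1) - 2) / 2 = (real m - 1) / 2"
      by simp_all
    then show "(LBINT t. J (m + 1) t) / (2 * pi) \<le> C3 m / real n powr ((real m - 1) / 2)"
      using J(2)[OF m3] unfolding C3_def by metis
    show "(LBINT t. J m t) / (2 * pi) \<le> C4 m / 2 / real n powr ((real m - 2) / 2)"
      using J(2)[OF m] unfolding C4_def by (simp add: mult_ac)
  qed (use \<nu> E \<sigma> in \<open>auto simp: b_const_def\<close>)
  finally show ?thesis
    by (simp add: \<nu>\<^sub>1_def \<nu>\<^sub>2_def \<nu>_def mult_ac)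
qed

end

section \<open>Transfer to the normalized sums\<close>

lemma (in prob_space) char_normalized_sum:
  assumes indep: "indep_vars (\<lambda>_. borel) \<xi> {1..}" and ident: "\<And>i. i \<ge> 1 \<Longrightarrow> distr M borel (\<xi> i) = L"
  shows "char (distr M borel (normalized_sum \<xi> \<sigma> n)) t = char L (t / (\<sigma> * sqrt (real n))) ^ n"
proof -
  have [measurable]: "\<xi> i \<in> borel_measurable M" if "i \<ge> 1" for i
    using indep that by (auto simp: indep_vars_def)
  have sum: "(\<lambda>\<omega>. \<Sum>i=1..n. \<xi> i \<omega>) \<in> borel_measurable M"
    by (rule borel_measurable_sum) auto
  then have [measurable]: "normalized_sum \<xi> \<sigma> n \<in> borel_measurable M"
    unfolding normalized_sum_def[abs_def] by simp
  have "char (distr M borel (normalized_sum \<xi> \<sigma> n)) t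
      = char (distr M borel (\<lambda>\<omega>. \<Sum>i=1..n. \<xi> i \<omega>)) (t / (\<sigma> * sqrt (real n)))"
    unfolding char_def using sum by (simp add: integral_distr normalized_sum_def)
  also have "\<dots> = (\<Prod>i=1..n. char (distr M borel (\<xi> i)) (t / (\<sigma> * sqrt (real n))))"
    by (rule char_distr_sum) (rule indep_vars_subset[OF indep], auto)
  finally show ?thesis
    by (simp add: ident)
qed

text \<open>The normal law is itself an instance of the inversion theorem, and a law has only one
  continuous density. In this form both densities can be subtracted under one inversion
  integral.\<close>

lemma std_normal_density_eq_inverse_char:
  "std_normal_density x = Re (inverse_char (\<lambda>t. complex_of_real (exp (- (t\<^sup>2) / 2))) x)"
  and integrable_char_std_normal: "integrable lborel (\<lambda>t. cmod (complex_of_real (exp (- (t\<^sup>2) / 2))))"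
proof -
  have "(\<lambda>t. sqrt (2 * pi) * (std_normal_density t * t ^ 0)) = (\<lambda>t. cmod (complex_of_real (exp (- (t\<^sup>2) / 2))))"
    unfolding norm_of_real abs_exp_cancel by (simp add: std_normal_density_def)
  then show int: "integrable lborel (\<lambda>t. cmod (complex_of_real (exp (- (t\<^sup>2) / 2))))"
    using integrable_mult_right[OF integrable_std_normal_moment[of 0], of "sqrt (2 * pi)"] by simp
  interpret N: real_distribution std_normal_law
    unfolding std_normal_law_def by (rule real_dist_normal_dist)
  have char: "char std_normal_law = (\<lambda>t. complex_of_real (exp (- (t\<^sup>2) / 2)))"
    by (simp add: fun_eq_iff char_std_normal_law)
  have "is_continuous_density std_normal_law std_normal_density"
    unfolding is_continuous_density_def std_normal_law_def
    by (auto simp: std_normal_density_def[abs_def] intro!: continuous_intros)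
  from is_continuous_density_unique[OF this N.is_continuous_density_inverse_char] int
  show "std_normal_density x = Re (inverse_char (\<lambda>t. complex_of_real (exp (- (t\<^sup>2) / 2))) x)"
    by (simp add: char fun_eq_iff)
qed

theorem theorem2:
  fixes M :: "'a measure" and L :: "real measure" and \<xi> :: "nat \<Rightarrow> 'a \<Rightarrow> real"
    and \<sigma> A :: real and m :: nat
  assumes "prob_space M"
    and m: "m \<ge> 3"
    and indep: "prob_space.indep_vars M (\<lambda>_. borel) \<xi> {1..}"
    and ident: "\<And>i. i \<ge> 1 \<Longrightarrow> distr M borel (\<xi> i) = L"
    and square_integrable: "\<And>i. i \<ge> 1 \<Longrightarrow> integrable M (\<lambda>\<omega>. (\<xi> i \<omega>)\<^sup>2)"
    and mean: "\<And>i. i \<ge> 1 \<Longrightarrow> (LINT \<omega>|M. \<xi> i \<omega>) = 0"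
    and variance: "\<And>i. i \<ge> 1 \<Longrightarrow> (LINT \<omega>|M. (\<xi> i \<omega> - (LINT \<omega>'|M. \<xi> i \<omega>'))\<^sup>2) = \<sigma>\<^sup>2"
    and sigma: "\<sigma> > 0"
    and pseudomoments: "\<And>k. k \<in> {3..m} \<Longrightarrow> pseudomoment_exists L \<sigma> k"
    and char_integrable: "integrable lborel (\<lambda>t. cmod (char L t))"
    and A: "A = (LINT t|lborel. cmod (char L t))"
    and pseudomoments_zero: "\<And>k. k \<in> {3..m} \<Longrightarrow> pseudomoment L \<sigma> k = 0"
  shows "b_const A \<sigma> < 1 \<and>
    (\<forall>n\<ge>2. nu L \<sigma> n m < 1 / 2 * exp (- 3 / 2) \<longrightarrow>
      (SUP x. ereal \<bar>continuous_density (distr M borel (normalized_sum \<xi> \<sigma> n)) x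
                       - std_normal_density x\<bar>)
      \<le> ereal (C3 m * nu1 L \<sigma> n m / real n powr ((real m - 1) / 2)
               + C4 m * nu2 L \<sigma> n m / real n powr ((real m - 2) / 2)
               + b_const A \<sigma> ^ (n - 1) * (\<sigma> * sqrt (real n) / (2 * pi)) * A
               + nu L \<sigma> n m * (exp (3 / 2) / pi) * (exp (- real n / 2) / real n)))"
proof -
  interpret M: prob_space M by fact
  have rv: "\<xi> i \<in> borel_measurable M" if "i \<ge> 1" for i
    using indep that by (auto simp: M.indep_vars_def)
  have L: "L = distr M borel (\<xi> 1)"
    using ident[of 1] by simp
  have "prob_space L"
    unfolding L by (rule M.prob_space_distr) (simp add: rv)
  then interpret L: real_distribution L
    by (simp add: real_distribution_def real_distribution_axioms_def L)
  have sq: "integrable L (\<lambda>x. x\<^sup>2)"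
    unfolding L using rv square_integrable[of 1] by (subst integrable_distr_eq) auto
  have meanL: "(LINT x|L. x) = 0"
    unfolding L using rv mean[of 1] by (subst integral_distr) auto
  have varL: "(LINT x|L. x\<^sup>2) = \<sigma>\<^sup>2"
    unfolding L using rv variance[of 1] mean[of 1] by (subst integral_distr) auto
  have A0: "0 < A"
    unfolding A by (rule L.cmod_char_le_b_const(1)[OF char_integrable sigma sq meanL varL])
  have "0 < pi\<^sup>2 / (24 * A\<^sup>2 * \<sigma>\<^sup>2 * (2 + pi)\<^sup>2)"
    using A0 sigma pi_gt_zero by (intro divide_pos_pos mult_pos_pos zero_less_power) (auto intro: add_pos_pos)
  then have b: "b_const A \<sigma> < 1"
    by (simp add: b_const_def del: zero_less_divide_iff divide_less_0_iff)
  have m': "m \<in> {3..m}"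
    using m by simp
  have "\<bar>continuous_density (distr M borel (normalized_sum \<xi> \<sigma> n)) x - std_normal_density x\<bar>
      \<le> C3 m * nu1 L \<sigma> n m / real n powr ((real m - 1) / 2)
               + C4 m * nu2 L \<sigma> n m / real n powr ((real m - 2) / 2)
               + b_const A \<sigma> ^ (n - 1) * (\<sigma> * sqrt (real n) / (2 * pi)) * A
               + nu L \<sigma> n m * (exp (3 / 2) / pi) * (exp (- real n / 2) / real n)"
    if n: "n \<ge> 2" and nu: "nu L \<sigma> n m < 1 / 2 * exp (- 3 / 2)" for n x
  proof -
    let ?Q = "distr M borel (normalized_sum \<xi> \<sigma> n)" and ?w = "\<lambda>t. complex_of_real (exp (- (t\<^sup>2) / 2))"
    define f where "f t = char L (t / (\<sigma> * sqrt (real n))) ^ n" for t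
    have Q: "char ?Q = f"
      by (simp add: fun_eq_iff f_def M.char_normalized_sum[OF indep ident])
    have "(\<lambda>\<omega>. \<Sum>i=1..n. \<xi> i \<omega>) \<in> borel_measurable M"
      by (rule borel_measurable_sum) (simp add: rv)
    then have "normalized_sum \<xi> \<sigma> n \<in> borel_measurable M"
      unfolding normalized_sum_def[abs_def] by simp
    then interpret Q: real_distribution ?Q
      by (simp add: real_distribution_def real_distribution_axioms_def M.prob_space_distr)
    have [measurable]: "f \<in> borel_measurable borel"
      unfolding Q[symmetric] by (rule Q.char_measurable)
    have f_int: "integrable lborel (\<lambda>t. cmod (f t))"
    proof (rule Bochner_Integration.integrable_bound)
      have "1 / (\<sigma> * sqrt (real n)) \<noteq> 0"
        using sigma n by simp
      from lborel_integrable_real_affine[OF char_integrable this, of 0]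
      show "integrable lborel (\<lambda>t. cmod (char L (t / (\<sigma> * sqrt (real n)))))"
        by simp
      \<comment> \<open>A characteristic function has modulus at most 1, so its n-th power inherits
        integrability from the first.\<close>
      have "cmod (f t) \<le> cmod (char L (t / (\<sigma> * sqrt (real n))))" for t
        using power_decreasing[of 1 n "cmod (char L (t / (\<sigma> * sqrt (real n))))"] n L.cmod_char_le_1
        by (simp add: f_def norm_power)
      then show "AE t in lborel. norm (cmod (f t)) \<le> norm (cmod (char L (t / (\<sigma> * sqrt (real n)))))"
        by simp
    qed simp
    have "continuous_density ?Q = (\<lambda>x. Re (inverse_char f x))"
      using Q.is_continuous_density_inverse_char f_int unfolding Q by (intro continuous_density_eq) simp
    then have "\<bar>continuous_density ?Q x - std_normal_density x\<bar> = \<bar>Re (inverse_char f x - inverse_char ?w x)\<bar>"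
      by (simp add: std_normal_density_eq_inverse_char)
    also have "\<dots> \<le> cmod (inverse_char f x - inverse_char ?w x)"
      by (rule abs_Re_le_cmod)
    also have "\<dots> \<le> (LBINT t. cmod (f t - ?w t)) / (2 * pi)"
      by (rule cmod_inverse_char_diff_le) (use f_int integrable_char_std_normal in auto)
    also have "\<dots> \<le> C3 m * nu1 L \<sigma> n m / real n powr ((real m - 1) / 2)
               + C4 m * nu2 L \<sigma> n m / real n powr ((real m - 2) / 2)
               + b_const A \<sigma> ^ (n - 1) * (\<sigma> * sqrt (real n) / (2 * pi)) * A
               + nu L \<sigma> n m * (exp (3 / 2) / pi) * (exp (- real n / 2) / real n)"
      unfolding f_def A
      by (rule L.integral_cmod_char_power_diff_le[OF char_integrable sigma m n sq meanL varL
            pseudomoments[OF m'] pseudomoments_zero nu])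
    finally show ?thesis .
  qed
  with b show ?thesis
    by (auto intro!: SUP_least)
qed

end
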